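(* Let $d\ge 1$ and $b\geq 1$ be integers and let $G$ be a connected $d$-regular graph. If $\lambda_2(G)<\phi(d,b)$, then $\tau(G)\geq \frac{1}{b}$, where $$\phi(d,b)=\begin{cases}\alpha_d & \text{if } \lceil d/b\rceil\le 2,\\[2pt] \frac{d-2+\sqrt{d^2+4d+8-4\lceil d/b\rceil}}{2} & \text{if } \lceil d/b\rceil\ge 3 \text{ is odd},\\[2pt] \frac{d-3+\sqrt{d^2+6d+13-4\lceil d/b\rceil}}{2} & \text{if } \lceil d/b\rceil\ge 3 \text{ is even and } d \text{ is odd},\\[2pt] \frac{d-2+\sqrt{d^2+4d+12-4\lceil d/b\rceil}}{2} & \text{if } \lceil d/b\rceil\ge 3 \text{ and } d \text{ are both even},\end{cases}$$ and $\alpha_d$ is the largest root of $x^3-(d-2)x^2-2dx+d-1=0$.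
   Context: All graphs are finite, simple and undirected. For a graph $G$, $\lambda_1(G)\ge\lambda_2(G)\ge\cdots\ge\lambda_n(G)$ are the eigenvalues of its adjacency matrix. $c(G)$ denotes the number of connected components of $G$. The toughness of a non-complete graph $G$ is $\tau(G)=\min\{|S|/c(G-S): S \text{ is a vertex cut of } G\}$; $G$ is $t$-tough if $\tau(G)\ge t$ (a complete graph, having no vertex cut, is regarded as $t$-tough for every $t$). *)

theory Defs
  imports
    "Graph_Theory.Kuratowski"
    "Jordan_Normal_Form.Char_Poly"
    "HOL-Library.Multiset"
begin

text \<open>
  Finite simple undirected graphs are the locale \<^locale>\<open>graph\<close>: finite symmetric digraphs without
  loops and parallel arcs, an edge being a pair of opposite arcs. So the out-degree of a vertex is
  its number of neighbours.
\<close>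

definition regular_graph :: "nat \<Rightarrow> ('a, 'b) pre_digraph \<Rightarrow> bool" where
  "regular_graph d G \<longleftrightarrow> (\<forall>v \<in> verts G. out_degree G v = d)"


subsection \<open>Eigenvalues\<close>

definition adjacency_matrix :: "('a, 'b) pre_digraph \<Rightarrow> 'a list \<Rightarrow> real mat" where
  "adjacency_matrix G vs =
     mat (length vs) (length vs) (\<lambda>(i, j). if vs ! i \<rightarrow>\<^bsub>G\<^esub> vs ! j then 1 else 0)"

text \<open>
  The chosen enumeration of the vertices is immaterial: another one conjugates the adjacency matrix
  by a permutation matrix. The matrix is real symmetric, so its characteristic polynomial has
  exactly \<open>n\<close> real roots with multiplicity, and these are all its eigenvalues.
\<close>

definition vertex_enumeration :: "('a, 'b) pre_digraph \<Rightarrow> 'a list" where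
  "vertex_enumeration G = (SOME vs. distinct vs \<and> set vs = verts G)"

definition graph_eigenvalues :: "('a, 'b) pre_digraph \<Rightarrow> real multiset" where
  "graph_eigenvalues G = proots (char_poly (adjacency_matrix G (vertex_enumeration G)))"

text \<open>
  The \<open>i\<close>-th largest eigenvalue with multiplicity, for \<open>1 \<le> i \<le> n\<close> (unspecified otherwise).
\<close>

definition graph_lambda :: "nat \<Rightarrow> ('a, 'b) pre_digraph \<Rightarrow> real" where
  "graph_lambda i G = rev (sorted_list_of_multiset (graph_eigenvalues G)) ! (i - 1)"


subsection \<open>Toughness\<close>

text \<open>
  The predicate \<^const>\<open>Digraph_Component.connected\<close> is false for the graph without vertices, which
  therefore has no components.
\<close>

definition graph_components :: "('a, 'b) pre_digraph \<Rightarrow> ('a, 'b) pre_digraph set" where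
  "graph_components G = {H. pre_digraph.max_subgraph G Digraph_Component.connected H}"

definition num_components :: "('a, 'b) pre_digraph \<Rightarrow> nat" where
  "num_components G = card (graph_components G)"

definition delete_vertices :: "('a, 'b) pre_digraph \<Rightarrow> 'a set \<Rightarrow> ('a, 'b) pre_digraph" where
  "delete_vertices G S = G \<restriction> (verts G - S)"

text \<open>
  A vertex cut is a set of vertices whose deletion disconnects the graph. Requiring two components
  excludes \<^prop>\<open>S = verts G\<close>.
\<close>

definition vertex_cut :: "('a, 'b) pre_digraph \<Rightarrow> 'a set \<Rightarrow> bool" where
  "vertex_cut G S \<longleftrightarrow> S \<subseteq> verts G \<and> num_components (delete_vertices G S) \<ge> 2"

text \<open>Meaningful for non-complete graphs only: a complete graph has no vertex cut.\<close>

definition toughness :: "('a, 'b) pre_digraph \<Rightarrow> real" where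
  "toughness G =
     Min {real (card S) / real (num_components (delete_vertices G S)) | S. vertex_cut G S}"

definition tough :: "real \<Rightarrow> ('a, 'b) pre_digraph \<Rightarrow> bool" where
  "tough t G \<longleftrightarrow> (\<exists>n. complete_digraph n G) \<or> toughness G \<ge> t"


subsection \<open>The spectral bound\<close>

definition alpha :: "nat \<Rightarrow> real" where
  "alpha d = Max {x. x ^ 3 - (real d - 2) * x ^ 2 - 2 * real d * x + real d - 1 = 0}"

definition phi :: "nat \<Rightarrow> nat \<Rightarrow> real" where
  "phi d b =
     (let c = \<lceil>real d / real b\<rceil> in
      if c \<le> 2 then alpha d
      else if odd c then
        (real d - 2 + sqrt (real d ^ 2 + 4 * real d + 8 - 4 * of_int c)) / 2
      else if odd d then
        (real d - 3 + sqrt (real d ^ 2 + 6 * real d + 13 - 4 * of_int c)) / 2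
      else
        (real d - 2 + sqrt (real d ^ 2 + 4 * real d + 12 - 4 * of_int c)) / 2)"

end

theory Submission
  imports Defs
begin

text \<open>
  Suppose that deleting \<open>S\<close> leaves more than \<open>b |S|\<close> components. Every component sends an edge to \<open>S\<close>
  and together they send at most \<open>d |S|\<close>, so at least two of them send fewer than \<open>d / b\<close> edges, that
  is at most \<open>\<lceil>d/b\<rceil> - 1\<close>. Such a component \<open>C\<close> has more than \<open>d\<close> vertices and is nearly
  \<open>d\<close>-regular: the deficiencies \<open>h(v) = d - deg\<^sub>C(v)\<close> sum to at most \<open>\<lceil>d/b\<rceil> - 1\<close>, with the parity of
  \<open>d |C|\<close>. If \<open>C\<close> is large, the constant vector has Rayleigh quotient at least \<open>\<phi>(d,b)\<close>; for the
  smallest possible sizes an explicit perturbation of it does. As the two components are not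
  adjacent, the quadratic form of the adjacency matrix is at least \<open>\<phi>(d,b)\<close> times the squared norm on
  the plane spanned by the two vectors, so \<open>\<lambda>\<^sub>2 \<ge> \<phi>(d,b)\<close>.
\<close>


subsection \<open>Rayleigh quotients of nearly regular graphs\<close>

text \<open>Write k for the ceiling of d/b and e for the sum of the deficiencies of C. The branches
  of \<open>phi\<close> record which pairs (|C|, e) parity allows. On d + 1 vertices e is even,
  because d (d + 1) is; for even d it is even on any number of vertices. So for odd k the extreme
  case is e = k - 1 on d + 1 vertices; for k and d even it is e = k - 2 on d + 1 vertices; for k
  even and d odd, e = k - 1 is possible only from d + 2 vertices on, and that case gives a bound no
  larger than e = k - 2 on d + 1 vertices. Each of these has a two-class quotient, hence a quadratic
  equation and a square root in \<open>phi\<close>. The pattern breaks for k \<le> 2. With e = 1 on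
  d + 2 vertices the only deficient vertex has degree 2 in the complement, so its complement
  neighbours have deficiency 0 and two classes no longer suffice. Three classes do, which is the
  origin of the cubic for \<open>alpha\<close>. The estimates are made in the complement of C, where
  the degrees |C| - 1 - d + h(v) are small as long as |C| is close to d + 1.\<close>

definition quad :: "'a set \<Rightarrow> ('a \<Rightarrow> 'a \<Rightarrow> bool) \<Rightarrow> ('a \<Rightarrow> real) \<Rightarrow> real" where
  "quad C E y = (\<Sum>u\<in>C. \<Sum>v\<in>C. of_bool (E u v) * (y u * y v))"

text \<open>The truncated subtraction is exact wherever degrees inside \<open>C\<close> are at most
  \<open>d\<close>, which the locale below assumes.\<close>

definition deficiency :: "'a set \<Rightarrow> ('a \<Rightarrow> 'a \<Rightarrow> bool) \<Rightarrow> nat \<Rightarrow> 'a \<Rightarrow> nat" where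
  "deficiency C E d u = d - card {v\<in>C. E u v}"

text \<open>For finite \<open>C\<close> this says that the largest eigenvalue of the graph induced
  on \<open>C\<close> is at least \<theta>. It is phrased through a witness vector because the
  vectors of two components are later combined into a plane.\<close>

definition rayleigh_ge :: "'a set \<Rightarrow> ('a \<Rightarrow> 'a \<Rightarrow> bool) \<Rightarrow> real \<Rightarrow> bool" where
  "rayleigh_ge C E \<theta> \<longleftrightarrow>
     (\<exists>y. (\<exists>v\<in>C. y v \<noteq> 0) \<and> quad C E y \<ge> \<theta> * (\<Sum>v\<in>C. y v ^ 2))"

lemma rayleigh_ge_mono: "rayleigh_ge C E \<theta> \<Longrightarrow> \<theta>' \<le> \<theta> \<Longrightarrow> rayleigh_ge C E \<theta>'"
  unfolding rayleigh_ge_def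
  by (meson mult_right_mono order_trans sum_nonneg zero_le_power2)

section \<open>Nearly regular graphs: deficiencies, complement and test vectors\<close>

locale near_regular =
  fixes C :: "'a set" and E :: "'a \<Rightarrow> 'a \<Rightarrow> bool" and d :: nat
  assumes fin: "finite C" and nonempty: "C \<noteq> {}"
    and sym: "E u v \<Longrightarrow> E v u" and irrefl: "\<not> E u u"
    and deg: "u \<in> C \<Longrightarrow> card {v\<in>C. E u v} \<le> d"
begin

abbreviation h :: "'a \<Rightarrow> nat" where "h \<equiv> deficiency C E d"

abbreviation e :: nat where "e \<equiv> \<Sum>u\<in>C. h u"

definition co :: "'a \<Rightarrow> 'a \<Rightarrow> real" where
  "co u v = of_bool (u \<noteq> v \<and> \<not> E u v)"

lemma sum_adj: "u \<in> C \<Longrightarrow> (\<Sum>v\<in>C. of_bool (E u v)) = real d - real (h u)"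
  using deg[of u] fin
  by (simp add: deficiency_def of_nat_diff sum.If_cases of_bool_def Int_def conj_commute)

text \<open>The constant vector has Rayleigh quotient \<open>d - e / card C\<close>.\<close>

lemma rayleigh_ge_const:
  assumes "real (card C) * (real d - \<theta>) \<ge> real e"
  shows "rayleigh_ge C E \<theta>"
proof -
  have "quad C E (\<lambda>_. 1) = real (card C) * real d - real e"
    using sum_adj by (simp add: quad_def sum_subtractf)
  then show ?thesis
    using assms nonempty unfolding rayleigh_ge_def
    by (intro exI[of _ "\<lambda>_. 1"]) (auto simp: algebra_simps)
qed

lemma co_sym: "co u v = co v u"
  using sym by (auto simp: co_def)

lemma sum_co: "u \<in> C \<Longrightarrow> (\<Sum>v\<in>C. co u v) = real (card C) - 1 - real d + real (h u)"
proof -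
  assume u: "u \<in> C"
  have "(\<Sum>v\<in>C. co u v) = (\<Sum>v\<in>C. 1 - of_bool (u = v) - of_bool (E u v))"
    by (intro sum.cong) (use irrefl in \<open>auto simp: co_def\<close>)
  also have "\<dots> = real (card C) - (\<Sum>v\<in>C. of_bool (u = v)) - (real d - real (h u))"
    using sum_adj[OF u] by (simp add: sum_subtractf)
  also have "(\<Sum>v\<in>C. of_bool (u = v)) = (1::real)"
    using u fin by (simp add: of_bool_def)
  finally show ?thesis by simp
qed

text \<open>The adjacency matrix is J - I minus that of the complement (J the all-ones matrix). What
  remains to be estimated is a form whose row sums depend on \<open>h\<close> alone, by
  \<open>sum_co\<close>.\<close>

lemma quad_co:
  "quad C E y = (\<Sum>v\<in>C. y v)^2 - (\<Sum>v\<in>C. y v ^ 2) - (\<Sum>u\<in>C. \<Sum>v\<in>C. co u v * (y u * y v))"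
proof -
  have "quad C E y = (\<Sum>u\<in>C. \<Sum>v\<in>C. y u * y v - of_bool (u = v) * (y u * y v) - co u v * (y u * y v))"
    unfolding quad_def
    by (intro sum.cong) (use irrefl in \<open>auto simp: co_def\<close>)
  also have "\<dots> = (\<Sum>u\<in>C. \<Sum>v\<in>C. y u * y v) - (\<Sum>u\<in>C. \<Sum>v\<in>C. of_bool (u = v) * (y u * y v))
      - (\<Sum>u\<in>C. \<Sum>v\<in>C. co u v * (y u * y v))"
    by (simp add: sum_subtractf)
  also have "(\<Sum>u\<in>C. \<Sum>v\<in>C. y u * y v) = (\<Sum>v\<in>C. y v)^2"
    by (simp add: power2_eq_square sum_product)
  also have "(\<Sum>u\<in>C. \<Sum>v\<in>C. of_bool (u = v) * (y u * y v)) = (\<Sum>v\<in>C. y v ^ 2)"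
  proof (intro sum.cong refl)
    fix u assume "u \<in> C"
    moreover have "(\<Sum>v\<in>C. of_bool (u = v) * (y u * y v)) = (\<Sum>v\<in>C. if u = v then y u ^ 2 else 0)"
      by (intro sum.cong) (auto simp: power2_eq_square)
    ultimately show "(\<Sum>v\<in>C. of_bool (u = v) * (y u * y v)) = y u ^ 2"
      using fin by simp
  qed
  finally show ?thesis .
qed

text \<open>A vertex has at most \<open>card C - 1\<close> neighbours in \<open>C\<close>, so its
  deficiency is at least \<open>d + 1 - card C\<close>. If 1 \<le> |C| \<le> d, the total is at
  least |C| (d + 1 - |C|), which is smallest at the two ends of this range, where it equals
  d.\<close>

lemma card_gt:
  assumes "e < d"
  shows "card C \<ge> d + 1"
proof (rule ccontr)
  assume "\<not> ?thesis"
  then have le: "card C \<le> d" by simp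
  have pos: "card C > 0" using fin nonempty by (simp add: card_gt_0_iff)
  have "h u \<ge> d + 1 - card C" if u: "u \<in> C" for u
  proof -
    have "{v\<in>C. E u v} \<subseteq> C - {u}" using irrefl by auto
    then have "card {v\<in>C. E u v} \<le> card C - 1"
      using card_mono[of "C - {u}"] fin u by fastforce
    then show ?thesis using pos by (simp add: deficiency_def)
  qed
  then have "card C * (d + 1 - card C) \<le> e"
    using sum_bounded_below[of C "d + 1 - card C" h] by simp
  moreover have "d \<le> card C * (d + 1 - card C)"
  proof -
    obtain x where x: "card C = Suc x" using pos by (cases "card C") auto
    obtain y where y: "d = Suc x + y" using le x le_Suc_ex by metis
    show ?thesis unfolding x y by (simp add: algebra_simps)
  qed
  ultimately show False using assms by simp
qed

text \<open>Handshake lemma: the degrees inside \<open>C\<close> have an even sum, by counting edges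
  as two-element sets, and together with the deficiencies they add up to
  \<open>d * card C\<close>.\<close>

lemma parity: "even (e + d * card C)"
proof -
  have "even (\<Sum>u\<in>C. card {v\<in>C. E u v})"
  proof -
    let ?P = "{(u,v). u \<in> C \<and> v \<in> C \<and> E u v}"
    have "(\<Sum>u\<in>C. card {v\<in>C. E u v}) = card (SIGMA u:C. {v\<in>C. E u v})"
      using fin by simp
    define L where "L = {X. \<exists>u v. X = {u,v} \<and> u \<in> C \<and> v \<in> C \<and> E u v}"
    have finL: "finite L" 
      by (rule finite_subset[of _ "Pow C"]) (use fin in \<open>auto simp: L_def\<close>)
    have "(\<Sum>u\<in>C. card {v\<in>C. E u v}) = (\<Sum>u\<in>C. card {X\<in>L. u \<in> X})"
    proof (intro sum.cong refl)
      fix u assume u: "u \<in> C"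
      have "bij_betw (\<lambda>v. {u,v}) {v\<in>C. E u v} {X\<in>L. u \<in> X}"
        unfolding bij_betw_def
      proof
        show "inj_on (\<lambda>v. {u, v}) {v \<in> C. E u v}"
          by (auto simp: inj_on_def doubleton_eq_iff)
        show "(\<lambda>v. {u, v}) ` {v \<in> C. E u v} = {X \<in> L. u \<in> X}"
          using u sym by (auto simp: L_def insert_commute)
      qed
      then show "card {v \<in> C. E u v} = card {X\<in>L. u \<in> X}" by (rule bij_betw_same_card)
    qed
    also have "\<dots> = (\<Sum>X\<in>L. card {u\<in>C. u \<in> X})"
      using sum_multicount_gen[OF fin finL, of "\<lambda>u X. u \<in> X" "\<lambda>X. card {u\<in>C. u \<in> X}"] by simp
    also have "\<dots> = (\<Sum>X\<in>L. 2)"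
    proof (intro sum.cong refl)
      fix X assume "X \<in> L"
      then obtain u v where *: "X = {u,v}" "u \<in> C" "v \<in> C" "E u v" by (auto simp: L_def)
      then have "u \<noteq> v" using irrefl by auto
      moreover have "{u\<in>C. u \<in> X} = {u,v}" using * by auto
      ultimately show "card {u\<in>C. u \<in> X} = 2" by simp
    qed
    finally show ?thesis by simp
  qed
  moreover have "e + (\<Sum>u\<in>C. card {v\<in>C. E u v}) = (\<Sum>u\<in>C. d)"
    unfolding sum.distrib[symmetric] by (intro sum.cong) (use deg in \<open>auto simp: deficiency_def\<close>)
  ultimately show ?thesis
    by (metis even_add mult.commute sum_constant of_nat_id)
qed

text \<open>
  The test vector is \<open>1 - h / T\<close> with \<open>T = \<theta> + 2 + s\<close>, where \<open>\<theta> = d - \<epsilon>\<close> is the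
  claimed bound. It is the Perron vector in the extremal case, where every deficiency is 0 or 1 and
  no vertex of deficiency 0 is joined in the complement to one of deficiency 1.
\<close>

lemma rayleigh_ge_slack:
  fixes s M :: nat and \<epsilon> :: real
  assumes card: "card C = d + 1 + s" and le: "e \<le> M"
    and root: "\<epsilon>^2 - (real d + 2 + real s) * \<epsilon> + real M = 0"
    and \<epsilon>: "0 \<le> \<epsilon>" "\<epsilon> \<le> 1"
  shows "rayleigh_ge C E (real d - \<epsilon>)"
proof -
  define N where "N = real (card C)"
  have N: "N = real d + 1 + real s" using card by (simp add: N_def)
  define T where "T = N + 1 - \<epsilon>"
  have T: "T \<ge> N" "T > 0" using \<epsilon> by (auto simp: T_def N)
  define t where "t = 1 / T"
  define x where "x = real e"
  define H where "H u = real (h u)" for u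
  have sumH: "(\<Sum>u\<in>C. H u) = x" by (simp add: H_def x_def)
  define Q where "Q = (\<Sum>u\<in>C. H u ^ 2)"
  define W where "W = (\<Sum>u\<in>C. \<Sum>v\<in>C. co u v * (H u * H v))"
  define y where "y u = 1 - t * H u" for u
  have Hle: "0 \<le> H u" "H u \<le> real d" for u by (auto simp: H_def deficiency_def)
  have co_row: "(\<Sum>v\<in>C. co u v) = H u + real s" if "u \<in> C" for u
    using sum_co[OF that] card by (simp add: H_def)
  have co_col: "(\<Sum>u\<in>C. co u v) = H v + real s" if "v \<in> C" for v
    using co_row[OF that] by (simp add: co_sym)
  have co_nonneg: "co u v \<ge> 0" for u v by (simp add: co_def)

  have rows: "(\<Sum>u\<in>C. \<Sum>v\<in>C. co u v * f u) = (\<Sum>u\<in>C. f u * (H u + real s))" for f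
    by (intro sum.cong) (auto simp: sum_distrib_right[symmetric] co_row)
  have cols: "(\<Sum>u\<in>C. \<Sum>v\<in>C. co u v * f v) = (\<Sum>u\<in>C. f u * (H u + real s))" for f
    by (subst sum.swap, intro sum.cong) (auto simp: sum_distrib_right[symmetric] co_col)

  \<comment> \<open>The inequality 2ab \<le> a^2 + b^2 trades the mixed complement form for
    complement row sums. It is sharp when complement edges join only vertices of equal
    deficiency.\<close>
  have "2 * W \<le> (\<Sum>u\<in>C. \<Sum>v\<in>C. co u v * H u ^ 2 + co u v * H v ^ 2)"
    unfolding W_def sum_distrib_left
  proof (intro sum_mono)
    fix u v
    have "2 * (H u * H v) \<le> H u ^ 2 + H v ^ 2"
      using sum_squares_bound[of "H u" "H v"] by simp
    from mult_left_mono[OF this co_nonneg[of u v]]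
    show "2 * (co u v * (H u * H v)) \<le> co u v * H u ^ 2 + co u v * H v ^ 2"
      by (simp add: algebra_simps)
  qed
  also have "\<dots> = 2 * (\<Sum>u\<in>C. H u ^ 2 * (H u + real s))"
    unfolding sum.distrib rows cols by simp
  finally have "W \<le> (\<Sum>u\<in>C. H u ^ 2 * (H u + real s))" by simp
  \<comment> \<open>The last two summands cancel. The bound is H^3 \<le> H^2 + d (H^2 - H), that is
    (d - H) H (H - 1) \<ge> 0, where integrality of the deficiency enters.\<close>
  also have "\<dots> \<le> (\<Sum>u\<in>C. (1 + real s) * H u ^ 2 + real d * (H u ^ 2 - H u) + (H u - H u ^ 2) + (H u^2 - H u))"
  proof (intro sum_mono)
    fix u
    have "H u * (H u - 1) \<ge> 0"
      unfolding H_def by (cases "h u") auto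
    then have "(real d - H u) * (H u * (H u - 1)) \<ge> 0" using Hle[of u] by simp
    then show "H u ^ 2 * (H u + real s) \<le>
      (1 + real s) * H u ^ 2 + real d * (H u ^ 2 - H u) + (H u - H u ^ 2) + (H u^2 - H u)"
      by (simp add: algebra_simps power2_eq_square power3_eq_cube)
  qed
  also have "\<dots> = (1 + real s) * Q + real d * (Q - x)"
    by (simp add: sum.distrib sum_subtractf sum_distrib_left[symmetric] Q_def sumH)
  finally have W: "W \<le> (1 + real s) * Q + real d * (Q - x)" .

  have Qx: "Q \<ge> x"
    unfolding Q_def sumH[symmetric]
  proof (intro sum_mono)
    fix u show "H u \<le> H u ^ 2"
      unfolding H_def by (cases "h u") (auto simp: power2_eq_square)
  qed

  have sy: "(\<Sum>u\<in>C. y u) = N - t * x"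
    by (simp add: y_def sum_subtractf N_def sumH sum_distrib_left[symmetric])
  have sy2: "(\<Sum>u\<in>C. y u ^ 2) = N - 2 * t * x + t^2 * Q"
    by (simp add: y_def power2_diff sum.distrib sum_subtractf N_def power_mult_distrib
        sum_distrib_left[symmetric] sumH Q_def mult.assoc[symmetric])
      
  have scy: "(\<Sum>u\<in>C. \<Sum>v\<in>C. co u v * (y u * y v)) = x + real s * N - 2 * t * (Q + real s * x) + t^2 * W"
  proof -
    have "(\<Sum>u\<in>C. \<Sum>v\<in>C. co u v * (y u * y v)) =
       (\<Sum>u\<in>C. \<Sum>v\<in>C. co u v * (1 - t * H u) + co u v * (- t * H v) + t^2 * (co u v * (H u * H v)))"
      by (intro sum.cong) (auto simp: y_def algebra_simps power2_eq_square)
    also have "\<dots> = (\<Sum>u\<in>C. (1 - t * H u) * (H u + real s)) + (\<Sum>u\<in>C. (- t * H u) * (H u + real s)) + t^2 * W"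
      unfolding sum.distrib rows cols W_def sum_distrib_left ..
    also have "\<dots> = (\<Sum>u\<in>C. H u + real s - 2 * t * (H u ^ 2) - 2 * t * real s * H u) + t^2 * W"
      unfolding sum.distrib[symmetric] by (simp add: algebra_simps power2_eq_square)
    also have "(\<Sum>u\<in>C. H u + real s - 2 * t * (H u ^ 2) - 2 * t * real s * H u) =
        x + real s * N - 2 * t * Q - 2 * t * real s * x"
      by (simp add: sum.distrib sum_subtractf sum_distrib_left[symmetric] Q_def sumH N_def)
    finally show ?thesis by (simp add: algebra_simps)
  qed

  \<comment> \<open>Multiplying by \<open>T^2\<close> clears t = 1/T and leaves a polynomial in
    \<open>T\<close>, \<open>N\<close>, \<open>x\<close>, \<open>Q\<close> and
    \<open>W\<close>.\<close>
  have "T^2 * (quad C E y - (real d - \<epsilon>) * (\<Sum>u\<in>C. y u ^ 2)) \<ge> 0"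
  proof -
    have tT: "T * t = 1" using T by (simp add: t_def)
    have "quad C E y - (real d - \<epsilon>) * (\<Sum>u\<in>C. y u ^ 2) =
      (N - t * x)^2 - (1 + real d - \<epsilon>) * (N - 2 * t * x + t^2 * Q)
        - (x + real s * N - 2 * t * (Q + real s * x) + t^2 * W)"
      unfolding quad_co sy sy2 scy by (simp add: algebra_simps)
    then have "T^2 * (quad C E y - (real d - \<epsilon>) * (\<Sum>u\<in>C. y u ^ 2)) = T^2 * \<dots>" by simp
    also have "\<dots> = (N * T - (T * t) * x)^2 - (1 + real d - \<epsilon>) * (N * T^2 - 2 * T * (T * t) * x + (T * t)^2 * Q)
        - (x * T^2 + real s * N * T^2 - 2 * T * (T * t) * (Q + real s * x) + (T * t)^2 * W)"
      by (simp add: algebra_simps power2_eq_square)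
    also have "\<dots> = (N * T - x)^2 - (1 + real d - \<epsilon>) * (N * T^2 - 2 * T * x + Q)
        - (x * T^2 + real s * N * T^2 - 2 * T * (Q + real s * x) + W)"
      by (simp add: tT)
    finally have eq: "T^2 * (quad C E y - (real d - \<epsilon>) * (\<Sum>u\<in>C. y u ^ 2)) =
        (N * T - x)^2 - (1 + real d - \<epsilon>) * (N * T^2 - 2 * T * x + Q)
        - (x * T^2 + real s * N * T^2 - 2 * T * (Q + real s * x) + W)" .
    have ge: "\<dots> \<ge> (N * T - x)^2 - (1 + real d - \<epsilon>) * (N * T^2 - 2 * T * x + Q)
        - (x * T^2 + real s * N * T^2 - 2 * T * (Q + real s * x) + ((1 + real s) * Q + real d * (Q - x)))"
      using W by simp
    have "(N * T - x)^2 - (1 + real d - \<epsilon>) * (N * T^2 - 2 * T * x + Q)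
        - (x * T^2 + real s * N * T^2 - 2 * T * (Q + real s * x) + ((1 + real s) * Q + real d * (Q - x)))
        = (Q - x) * (T - real d) + (real M - x) * (N * T - x)"
    proof -
      have M: "real M = \<epsilon> * T"
        using root by (simp add: T_def N power2_eq_square algebra_simps)
      have s: "real s = N - 1 - real d" by (simp add: N)
      have e: "\<epsilon> = N + 1 - T" by (simp add: T_def)
      show ?thesis unfolding M s e
        by (simp add: algebra_simps power2_eq_square power3_eq_cube)
    qed
    also have "\<dots> \<ge> 0"
    proof -
      have "x \<le> real M" using le unfolding x_def by linarith
      moreover have "real M \<le> N * T"
      proof -
        have "real M = \<epsilon> * T"
          using root by (simp add: T_def N power2_eq_square algebra_simps)
        moreover have "\<epsilon> \<le> N" using \<epsilon> by (simp add: N)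
        ultimately show ?thesis using T by simp
      qed
      moreover have "T \<ge> real d" using T by (simp add: N)
      ultimately show ?thesis using Qx by simp
    qed
    finally show ?thesis unfolding eq using ge by linarith
  qed
  then have "quad C E y \<ge> (real d - \<epsilon>) * (\<Sum>u\<in>C. y u ^ 2)"
    using T by (simp add: zero_le_mult_iff)
  moreover have "y u \<noteq> 0" for u
  proof -
    have "H u < T" using Hle[of u] T by (simp add: N)
    then show ?thesis using T by (simp add: y_def t_def field_simps)
  qed
  ultimately show ?thesis
    using nonempty unfolding rayleigh_ge_def by blast
qed

text \<open>
  Here the complement is a path \<open>P\<^sub>3\<close> with centre \<open>w\<close> together with a perfect matching of the other
  vertices. The cubic is the characteristic polynomial of the quotient by \<open>{w}\<close>, the two ends of the
  path, and the rest; the test vector is its eigenvector \<open>((d-1)/\<alpha>, (d-1)/(\<alpha>-1), 1)\<close>.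
\<close>

lemma rayleigh_ge_cubic:
  fixes \<alpha> :: real
  assumes card: "card C = d + 2" and e: "e = 1" and \<alpha>: "\<alpha> > 1"
    and root: "\<alpha> ^ 3 - (real d - 2) * \<alpha> ^ 2 - 2 * real d * \<alpha> + real d - 1 = 0"
  shows "rayleigh_ge C E \<alpha>"
proof -
  obtain w where w: "w \<in> C" "h w = 1" and h0: "\<And>u. u \<in> C \<Longrightarrow> u \<noteq> w \<Longrightarrow> h u = 0"
    using e sum_eq_1_iff[OF fin, of h] by metis
  have row_w: "(\<Sum>v\<in>C. co w v) = 2"
    using sum_co[OF w(1)] card w(2) by simp
  have row: "(\<Sum>v\<in>C. co u v) = 1" if "u \<in> C" "u \<noteq> w" for u
    using sum_co[OF that(1)] card h0[OF that] by simp
  have co01: "co u v = 0 \<or> co u v = 1" for u v by (auto simp: co_def)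
  \<comment> \<open>A complement neighbour of \<open>w\<close> has complement degree 1, so
    \<open>w\<close> is its only complement neighbour: the two ends of the path.\<close>
  have unique: "v = w" if "u \<in> C" "u \<noteq> w" "co u w = 1" "v \<in> C" "co u v = 1" for u v
  proof (rule ccontr)
    assume "v \<noteq> w"
    have "(\<Sum>x\<in>{v,w}. co u x) \<le> (\<Sum>x\<in>C. co u x)"
      by (rule sum_mono2) (use fin that w(1) in \<open>auto simp: co_def\<close>)
    then show False using row[OF that(1,2)] that \<open>v \<noteq> w\<close> by simp
  qed
  define p q where "p = (real d - 1) / \<alpha>" and "q = (real d - 1) / (\<alpha> - 1)"
  \<comment> \<open>The value is p at \<open>w\<close>, q at the two complement neighbours of
    \<open>w\<close>, and 1 elsewhere.\<close>
  define y where "y u = 1 + (q - 1) * co w u + (p - 1) * of_bool (u = w)" for u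
  have delta: "(\<Sum>u\<in>C. of_bool (u = w)) = (1::real)"
    using fin w(1) by (simp add: of_bool_def)
  have lin: "(\<Sum>u\<in>C. 1 + k1 * co w u + k2 * of_bool (u = w)) = real d + 2 + 2 * k1 + k2" for k1 k2
    by (simp only: sum.distrib sum_distrib_left[symmetric] delta row_w) (simp add: card)
  have coww: "co w w = 0" by (simp add: co_def)
  \<comment> \<open>Two complement steps starting at \<open>w\<close> lead back to \<open>w\<close>,
    in two ways, and nowhere else.\<close>
  have common: "(\<Sum>v\<in>C. co u v * co w v) = 2 * of_bool (u = w)" if u: "u \<in> C" for u
  proof (cases "u = w")
    case True
    have "(\<Sum>v\<in>C. co w v * co w v) = (\<Sum>v\<in>C. co w v)"
      by (intro sum.cong) (auto simp: co_def)
    then show ?thesis using True row_w by simp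
  next
    case False
    have "co u v * co w v = 0" if v: "v \<in> C" for v
    proof (rule ccontr)
      assume "co u v * co w v \<noteq> 0"
      then have "co v w = 1" "co v u = 1" "v \<noteq> w"
        using co01[of u v] co01[of w v] by (auto simp: co_sym[of v] coww)
      then show False using unique[of v u] v u False by simp
    qed
    then have "(\<Sum>v\<in>C. co u v * co w v) = 0" by (rule sum.neutral[OF ballI])
    then show ?thesis using False by simp
  qed
  have row_y: "(\<Sum>v\<in>C. co u v * y v) = 1 + (p - 1) * co w u + (2 * q - 1) * of_bool (u = w)"
    if u: "u \<in> C" for u
  proof -
    have "(\<Sum>v\<in>C. co u v * y v) =
        (\<Sum>v\<in>C. co u v + (q - 1) * (co u v * co w v) + (p - 1) * (if v = w then co u w else 0))"
      by (intro sum.cong) (auto simp: y_def algebra_simps)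
    also have "\<dots> = (\<Sum>v\<in>C. co u v) + (q - 1) * (2 * of_bool (u = w)) + (p - 1) * co u w"
      using w(1) fin by (simp only: sum.distrib sum_distrib_left[symmetric] common[OF u] sum.delta if_True)
    also have "(\<Sum>v\<in>C. co u v) = 1 + of_bool (u = w)"
      using row_w row[OF u] by simp
    finally show ?thesis by (simp add: co_sym[of w u] algebra_simps)
  qed
  have s1: "(\<Sum>u\<in>C. y u) = real d + 2 + 2 * (q - 1) + (p - 1)"
    unfolding y_def by (rule lin)
  have "(\<Sum>u\<in>C. y u ^ 2) = (\<Sum>u\<in>C. 1 + (q^2 - 1) * co w u + (p^2 - 1) * of_bool (u = w))"
    by (intro sum.cong) (use co01 coww in \<open>auto simp: y_def co_def power2_eq_square\<close>)
  then have s2: "(\<Sum>u\<in>C. y u ^ 2) = real d + 2 + 2 * (q^2 - 1) + (p^2 - 1)"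
    unfolding lin .
  have "(\<Sum>u\<in>C. \<Sum>v\<in>C. co u v * (y u * y v)) = (\<Sum>u\<in>C. y u * (\<Sum>v\<in>C. co u v * y v))"
    by (simp add: sum_distrib_left mult_ac)
  also have "\<dots> = (\<Sum>u\<in>C. 1 + (p * q - 1) * co w u + (2 * p * q - 1) * of_bool (u = w))"
  proof (intro sum.cong refl)
    fix u assume "u \<in> C"
    then show "y u * (\<Sum>v\<in>C. co u v * y v) =
        1 + (p * q - 1) * co w u + (2 * p * q - 1) * of_bool (u = w)"
      using co01[of w u] coww unfolding row_y[OF \<open>u \<in> C\<close>] unfolding y_def
      by (cases "u = w") (auto simp: algebra_simps)
  qed
  finally have s3: "(\<Sum>u\<in>C. \<Sum>v\<in>C. co u v * (y u * y v)) = real d + 2 + 2 * (p * q - 1) + (2 * p * q - 1)"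
    unfolding lin .
  \<comment> \<open>The eigenvector equations at \<open>w\<close> (adjacent to the d - 1 remaining
    vertices) and at an end of the path (adjacent to these and to the other end).\<close>
  have ap: "\<alpha> * p = real d - 1" and aq: "\<alpha> * q = real d - 1 + q"
    using \<alpha> by (auto simp: p_def q_def field_simps)
  \<comment> \<open>The eigenvector equation at a remaining vertex: it sees \<open>w\<close>, both
    ends, and d - 3 of its own class. Multiplied by \<alpha> (\<alpha> - 1), it is the
    cubic.\<close>
  have a: "\<alpha> = p + 2 * q + real d - 3"
  proof -
    have "\<alpha> * (\<alpha> - 1) * \<alpha> = \<alpha> * (\<alpha> - 1) * (p + 2 * q + real d - 3)"
    proof -
      have "\<alpha> * (\<alpha> - 1) * (p + 2 * q + real d - 3) =
         (\<alpha> - 1) * (\<alpha> * p) + 2 * \<alpha> * (\<alpha> * q - q) + \<alpha> * (\<alpha> - 1) * (real d - 3)"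
        by (simp add: algebra_simps)
      also have "\<dots> = (\<alpha> - 1) * (real d - 1) + 2 * \<alpha> * (real d - 1) + \<alpha> * (\<alpha> - 1) * (real d - 3)"
        unfolding ap aq by simp
      also have "\<dots> = \<alpha> * (\<alpha> - 1) * \<alpha>"
        using root by (simp add: algebra_simps power2_eq_square power3_eq_cube)
      finally show ?thesis ..
    qed
    then show ?thesis using \<alpha> by simp
  qed
  have "\<alpha> * (\<Sum>u\<in>C. y u ^ 2) = p * (\<alpha> * p) + 2 * q * (\<alpha> * q) + (real d - 1) * \<alpha>"
    unfolding s2 by (simp add: algebra_simps power2_eq_square)
  also have "\<dots> = p * (real d - 1) + 2 * q * (real d - 1 + q) + (real d - 1) * (p + 2 * q + real d - 3)"
    unfolding ap aq using a by simp
  also have "\<dots> = quad C E y"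
    unfolding quad_co s1 s2 s3 by (simp add: algebra_simps power2_eq_square)
  finally have "quad C E y \<ge> \<alpha> * (\<Sum>u\<in>C. y u ^ 2)" by simp
  moreover have "y w \<noteq> 0"
  proof -
    have "d > 0"
    proof (rule ccontr)
      assume "\<not> d > 0"
      then have "h w = 0" by (simp add: deficiency_def)
      then show False using w by simp
    qed
    \<comment> \<open>For d = 1 the test vector would vanish at \<open>w\<close>; there the cubic is
      \<alpha> (\<alpha> - 1) (\<alpha> + 2), without roots above 1.\<close>
    have "d \<noteq> 1"
    proof
      assume "d = 1"
      then have "\<alpha> * (\<alpha> - 1) * (\<alpha> + 2) = 0"
        using root by (simp add: algebra_simps power2_eq_square power3_eq_cube)
      then show False using \<alpha> by auto
    qed
    then show ?thesis using \<open>d > 0\<close> \<alpha> by (simp add: y_def coww p_def)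
  qed
  ultimately show ?thesis
    using w(1) unfolding rayleigh_ge_def by blast
qed

end

text \<open>
  \<open>d - slack d s M\<close> is the largest eigenvalue of the two-class quotient of a graph on \<open>d + 1 + s\<close>
  vertices in which \<open>M\<close> vertices have degree \<open>d - 1\<close> and the others degree \<open>d\<close>. The last three
  branches of \<^const>\<open>phi\<close> are of this form.
\<close>

definition slack :: "nat \<Rightarrow> nat \<Rightarrow> nat \<Rightarrow> real" where
  "slack d s M = (real d + 2 + real s - sqrt ((real d + 2 + real s)^2 - 4 * real M)) / 2"

text \<open>With D = d + 2 + s, the assumption gives M \<le> D - 1, so the discriminant D^2 - 4M is
  at least (D - 2)^2. Hence the smaller root of the quadratic is real and at most 1.\<close>

lemma slack_bounds:
  assumes "M \<le> d"
  shows "0 \<le> slack d s M" "slack d s M \<le> 1"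
    and "slack d s M ^ 2 - (real d + 2 + real s) * slack d s M + real M = 0"
proof -
  define D where "D = real d + 2 + real s"
  have D: "real M \<le> D - 1" "D \<ge> 2" using assms by (auto simp: D_def)
  have ge: "(D - 2)^2 \<le> D^2 - 4 * real M" using D by (simp add: power2_diff)
  have "sqrt (D^2 - 4 * real M) \<le> sqrt (D^2)" by (intro real_sqrt_le_mono) simp
  then show "0 \<le> slack d s M" using D by (simp add: slack_def D_def[symmetric])
  have "D - 2 \<le> sqrt (D^2 - 4 * real M)" using ge by (rule real_le_rsqrt)
  then show "slack d s M \<le> 1" by (simp add: slack_def D_def[symmetric])
  have "D^2 - 4 * real M \<ge> 0" using ge by (meson order_trans zero_le_power2)
  then have "sqrt (D^2 - 4 * real M) ^ 2 = D^2 - 4 * real M" by simp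
  moreover define r where "r = sqrt (D^2 - 4 * real M)"
  ultimately have r: "r^2 = D^2 - 4 * real M" by simp
  have "((D - r) / 2)^2 - D * ((D - r) / 2) + real M = 0"
    using r by (simp add: power2_eq_square field_simps)
  then show "slack d s M ^ 2 - (real d + 2 + real s) * slack d s M + real M = 0"
    by (simp add: slack_def D_def[symmetric] r_def)
qed

text \<open>Subtracting the two quadratic equations leaves (b - a) (d + 3 - a - b) = 1 - a, with a
  positive second factor. This compares d + 1 with d + 2 vertices when the ceiling is even and d
  odd.\<close>

lemma slack_mono:
  assumes "M + 1 \<le> d"
  shows "slack d 0 M \<le> slack d 1 (M + 1)"
proof -
  define a b where "a = slack d 0 M" and "b = slack d 1 (M + 1)"
  have a: "0 \<le> a" "a \<le> 1" "a^2 - (real d + 2) * a + real M = 0"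
    using slack_bounds[of M d 0] assms by (simp_all add: a_def)
  have b: "0 \<le> b" "b \<le> 1" "b^2 - (real d + 3) * b + real M + 1 = 0"
    using slack_bounds[of "M + 1" d 1] assms by (simp_all add: b_def algebra_simps)
  have "(b - a) * (real d + 3 - a - b) = 1 - a"
    using a(3) b(3) by (simp add: algebra_simps power2_eq_square)
  moreover have "real d + 3 - a - b > 0" using a b by simp
  ultimately have "b - a \<ge> 0" using a(2)
    by (metis diff_ge_0_iff_ge zero_le_mult_iff not_less)
  then show ?thesis by (simp add: a_def b_def)
qed

text \<open>The cubic changes sign between d - 1 and d and is positive beyond d, where it equals x
  (x + 2) (x - d) + (d - 1). The root set must be shown finite and nonempty before its
  \<open>Max\<close> has a meaning.\<close>

lemma alpha_root:
  assumes "d \<ge> 1"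
  shows "alpha d ^ 3 - (real d - 2) * alpha d ^ 2 - 2 * real d * alpha d + real d - 1 = 0"
    and "real d - 1 \<le> alpha d" and "alpha d \<le> real d"
proof -
  define g where "g x = x ^ 3 - (real d - 2) * x ^ 2 - 2 * real d * x + real d - 1" for x :: real
  define R where "R = {x. g x = 0}"
  have "R = {x. poly [:real d - 1, - 2 * real d, - (real d - 2), 1:] x = 0}"
    by (simp add: R_def g_def algebra_simps power2_eq_square power3_eq_cube)
  moreover have "finite {x. poly [:real d - 1, - 2 * real d, - (real d - 2), 1:] x = 0}"
    by (rule poly_roots_finite) simp
  ultimately have fin: "finite R" by simp
  have "\<exists>x\<ge>real d - 1. x \<le> real d \<and> g x = 0"
  proof (rule IVT')
    have "g (real d - 1) = - ((real d - 1) * real d)"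
      by (simp add: g_def algebra_simps power2_eq_square power3_eq_cube)
    then show "g (real d - 1) \<le> 0" using assms by simp
    have "g (real d) = real d - 1"
      by (simp add: g_def algebra_simps power2_eq_square power3_eq_cube)
    then show "0 \<le> g (real d)" using assms by simp
    show "continuous_on {real d - 1..real d} g"
      unfolding g_def by (intro continuous_intros)
  qed simp
  then obtain x where x: "real d - 1 \<le> x" "x \<in> R" by (auto simp: R_def)
  have al: "alpha d = Max R" by (simp add: alpha_def R_def g_def)
  have mem: "alpha d \<in> R" unfolding al using fin x(2) by (intro Max_in) auto
  then show "alpha d ^ 3 - (real d - 2) * alpha d ^ 2 - 2 * real d * alpha d + real d - 1 = 0"
    by (simp add: R_def g_def)
  show "real d - 1 \<le> alpha d" unfolding al using x fin Max_ge[of R x] by linarith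
  show "alpha d \<le> real d"
  proof (rule ccontr)
    assume "\<not> alpha d \<le> real d"
    moreover define z where "z = alpha d"
    ultimately have z: "z > real d" by simp
    have "g z = z * (z + 2) * (z - real d) + (real d - 1)"
      by (simp add: g_def algebra_simps power2_eq_square power3_eq_cube)
    moreover have "z * (z + 2) * (z - real d) > 0" using z by (intro mult_pos_pos) auto
    ultimately have "g z > 0" using assms by simp
    then show False using mem by (simp add: R_def z_def)
  qed
qed

text \<open>What the constant vector needs when e = 1 and |C| \<ge> d + 4. In \<epsilon> = d -
  \<alpha> the cubic reads \<epsilon> (d - \<epsilon>) (d + 2 - \<epsilon>) = d - 1; a smaller
  \<epsilon> would make the left side too small.\<close>

lemma alpha_gap:
  assumes "d \<ge> 3"
  shows "(real d + 4) * (real d - alpha d) \<ge> 1"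
proof (rule ccontr)
  define D where "D = real d"
  define \<epsilon> where "\<epsilon> = D - alpha d"
  assume "\<not> ?thesis"
  then have lt: "(D + 4) * \<epsilon> < 1" by (simp add: D_def \<epsilon>_def)
  have D: "D \<ge> 3" using assms by (simp add: D_def)
  have al: "alpha d = D - \<epsilon>" by (simp add: \<epsilon>_def)
  have \<epsilon>: "0 \<le> \<epsilon>" "\<epsilon> \<le> 1" using alpha_root[of d] assms by (auto simp: \<epsilon>_def D_def)
  have eq: "\<epsilon> * ((D - \<epsilon>) * (D + 2 - \<epsilon>)) = D - 1"
    using alpha_root(1)[of d] assms unfolding al D_def[symmetric]
    by (simp add: algebra_simps power2_eq_square power3_eq_cube)
  have pos: "(D - \<epsilon>) * (D + 2 - \<epsilon>) > 0" using \<epsilon> D by simp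
  have "(D + 4) * (D - 1) = ((D + 4) * \<epsilon>) * ((D - \<epsilon>) * (D + 2 - \<epsilon>))"
    unfolding eq[symmetric] by (simp only: mult.assoc)
  also have "\<dots> < (D - \<epsilon>) * (D + 2 - \<epsilon>)"
    using mult_strict_right_mono[OF lt pos] by simp
  finally have *: "(D + 4) * (D - 1) < (D - \<epsilon>) * (D + 2 - \<epsilon>)" .
  have le: "(D - \<epsilon>) * (D + 2 - \<epsilon>) \<le> D * (D + 2)"
    using \<epsilon> D by (intro mult_mono) auto
  show False
  \<comment> \<open>The crude comparison (d + 4) (d - 1) \<ge> d (d + 2) starts at d = 4. For d = 3
    it reads 14 against 15, and the terms in \<epsilon> must be kept: \<epsilon> \<ge> 2/15
    contradicts \<epsilon> < 7/55.\<close>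
  proof (cases "d = 3")
    case True
    then have D3: "D = 3" by (simp add: D_def)
    have "2 \<le> \<epsilon> * 15" using mult_left_mono[OF le \<epsilon>(1)] eq by (simp add: D3)
    moreover have "\<epsilon> * \<epsilon> \<le> \<epsilon> * (1/7)" using lt \<epsilon> by (intro mult_left_mono) (auto simp: D3)
    moreover have "14 < 15 - 8 * \<epsilon> + \<epsilon> * \<epsilon>" using * by (simp add: D3 algebra_simps)
    ultimately show False by linarith
  next
    case False
    then have "D \<ge> 4" using assms by (simp add: D_def)
    then have "D * (D + 2) \<le> (D + 4) * (D - 1)" by (simp add: algebra_simps)
    then show False using * le by linarith
  qed
qed

section \<open>The bound \<open>phi\<close> for a sparse component\<close>

context near_regular
begin

text \<open>One vertex above the extremal size the constant vector is already enough: the quadratic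
  gives (d + 2 + s) \<epsilon> = M + \<epsilon>^2 \<ge> M.\<close>

lemma rayleigh_ge_slack':
  assumes "card C \<ge> d + 1 + s" and "e \<le> M" and "M \<le> d"
  shows "rayleigh_ge C E (real d - slack d s M)"
proof (cases "card C = d + 1 + s")
  case True
  then show ?thesis using rayleigh_ge_slack[OF True assms(2)] slack_bounds[OF assms(3)] by blast
next
  case False
  let ?\<epsilon> = "slack d s M"
  have "real d + 2 + real s \<le> real (card C)" using assms(1) False by linarith
  then have "(real d + 2 + real s) * ?\<epsilon> \<le> real (card C) * ?\<epsilon>"
    using slack_bounds(1)[OF assms(3)] by (rule mult_right_mono)
  moreover have "real M \<le> (real d + 2 + real s) * ?\<epsilon>"
    using slack_bounds(3)[OF assms(3), of s] zero_le_power2[of ?\<epsilon>] by linarith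
  ultimately have "real e \<le> real (card C) * ?\<epsilon>" using assms(2) by linarith
  then show ?thesis by (intro rayleigh_ge_const) simp
qed

text \<open>If e = 1, parity makes d and |C| odd, so |C| is d + 2, the case of the cubic, or at
  least d + 4.\<close>

lemma rayleigh_ge_alpha:
  assumes "e \<le> 1" and "e < d"
  shows "rayleigh_ge C E (alpha d)"
proof (cases "e = 0")
  case True
  then show ?thesis using alpha_root(3)[of d] assms
    by (intro rayleigh_ge_const) (simp del: of_nat_sum sum_eq_0_iff)
next
  case False
  then have e: "e = 1" using assms by linarith
  have od: "odd d" "odd (card C)" using parity e by auto
  have d3: "d \<ge> 3" using od assms e by (cases "d = 1"; cases "d = 2"; auto)
  have "card C \<ge> d + 1" by (rule card_gt[OF assms(2)])
  then have "card C = d + 2 \<or> card C \<ge> d + 4"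
    using od by presburger
  then show ?thesis
  proof
    assume "card C = d + 2"
    then show ?thesis using e alpha_root[of d] d3 by (intro rayleigh_ge_cubic) auto
  next
    assume "card C \<ge> d + 4"
    then have "(real d + 4) * (real d - alpha d) \<le> real (card C) * (real d - alpha d)"
      using alpha_root(3)[of d] d3 by (intro mult_right_mono) auto
    then show ?thesis using alpha_gap[OF d3] e by (intro rayleigh_ge_const) linarith
  qed
qed

theorem rayleigh_ge_phi:
  assumes "b \<ge> 1" and "b * e < d"
  shows "rayleigh_ge C E (phi d b)"
proof -
  define c where "c = \<lceil>real d / real b\<rceil>"
  define k where "k = nat c"
  have "e \<le> b * e" using assms(1) by simp
  then have ed: "e < d" using assms(2) by linarith
  have "real b * real e < real d"
    using assms(2) by (metis of_nat_less_iff of_nat_mult)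
  then have "real e < real d / real b" using assms(1) by (simp add: field_simps)
  then have ec: "int e < c" unfolding c_def by linarith
  then have "0 \<le> c" by linarith
  then have k: "c = int k" by (simp add: k_def)
  have ek: "e < k" using ec unfolding k of_nat_less_iff .
  have "real d / real b \<le> real d"
    using assms(1) mult_right_mono[of 1 "real b" "real d"] by (simp add: field_simps)
  then have kd: "k \<le> d" unfolding k_def c_def by linarith
  have card: "card C \<ge> d + 1" by (rule card_gt[OF ed])
  consider "k \<le> 2" | "k \<ge> 3" "odd k" | "k \<ge> 3" "even k" "odd d" | "k \<ge> 3" "even k" "even d"
    by linarith
  then show ?thesis
  proof cases
    case 1
    then have "phi d b = alpha d" using k by (simp add: phi_def c_def[symmetric])
    then show ?thesis using rayleigh_ge_alpha ed ek 1 by simp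
  next
    case 2
    then have "phi d b = (real d - 2 + sqrt (real d ^ 2 + 4 * real d + 8 - 4 * real k)) / 2"
      using k by (simp add: phi_def c_def[symmetric])
    \<comment> \<open>Here (d + 2)^2 - 4 (k - 1) is the radicand; the other two branches match in
      the same way.\<close>
    also have "\<dots> = real d - slack d 0 (k - 1)"
      using 2(1) by (simp add: slack_def of_nat_diff power2_eq_square algebra_simps diff_divide_distrib add_divide_distrib)
    finally have phi: "phi d b = real d - slack d 0 (k - 1)" .
    show ?thesis unfolding phi using card ek kd by (intro rayleigh_ge_slack') auto
  next
    case 3
    then have "phi d b = (real d - 3 + sqrt (real d ^ 2 + 6 * real d + 13 - 4 * real k)) / 2"
      using k by (simp add: phi_def c_def[symmetric])
    also have "\<dots> = real d - slack d 1 (k - 1)"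
      using 3(1) by (simp add: slack_def of_nat_diff power2_eq_square algebra_simps diff_divide_distrib add_divide_distrib)
    finally have phi: "phi d b = real d - slack d 1 (k - 1)" .
    show ?thesis
    \<comment> \<open>On d + 1 vertices e is even and so misses the odd value k - 1;
      \<open>slack_mono\<close> then shows that this size is no worse than d + 2 vertices.\<close>
    proof (cases "card C = d + 1")
      case True
      then have "even e" using parity 3 by auto
      then have "e \<le> k - 2" using ek 3 by (cases "e = k - 1") auto
      then have "rayleigh_ge C E (real d - slack d 0 (k - 2))"
        using kd card by (intro rayleigh_ge_slack') auto
      moreover have "slack d 0 (k - 2) \<le> slack d 1 (k - 1)"
        using slack_mono[of "k - 2" d] kd 3(1) by (simp add: Suc_diff_Suc numeral_eq_Suc)
      ultimately show ?thesis unfolding phi by (elim rayleigh_ge_mono) simp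
    next
      case False
      then show ?thesis unfolding phi using card ek kd by (intro rayleigh_ge_slack') auto
    qed
  next
    case 4
    then have "phi d b = (real d - 2 + sqrt (real d ^ 2 + 4 * real d + 12 - 4 * real k)) / 2"
      using k by (simp add: phi_def c_def[symmetric])
    also have "\<dots> = real d - slack d 0 (k - 2)"
      using 4(1) by (simp add: slack_def of_nat_diff power2_eq_square algebra_simps diff_divide_distrib add_divide_distrib)
    finally have phi: "phi d b = real d - slack d 0 (k - 2)" .
    have "even e" using parity 4 by auto
    then have "e \<le> k - 2" using ek 4 by (cases "e = k - 1") auto
    then show ?thesis unfolding phi using kd card by (intro rayleigh_ge_slack') auto
  qed
qed

end


subsection \<open>The second eigenvalue of a real symmetric matrix\<close>

text \<open>Over the complex numbers an eigenvector v exists. The form v* A v equals its own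
  conjugate and is the eigenvalue times |v|^2, so the eigenvalue is real and is a root of the real
  characteristic polynomial.\<close>

lemma real_symmetric_eigenvalue:
  fixes A :: "real mat"
  assumes A: "A \<in> carrier_mat n n" and sym: "transpose_mat A = A" and n: "n > 0"
  shows "\<exists>e. eigenvalue A e"
proof -
  let ?A = "map_mat complex_of_real A"
  have A': "?A \<in> carrier_mat n n" using A by simp
  obtain as where as: "char_poly ?A = (\<Prod>a\<leftarrow>as. [:- a, 1:])" "length as = n"
    using char_poly_factorized[OF A'] by blast
  then obtain a where "a \<in> set as" using n by (cases as) auto
  then have root: "poly (char_poly ?A) a = 0"
    by (auto simp: as(1) poly_prod_list prod_list_zero_iff image_iff intro!: bexI[of _ a])
  then obtain v where v: "v \<in> carrier_vec n" "v \<noteq> 0\<^sub>v n" "?A *\<^sub>v v = a \<cdot>\<^sub>v v"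
    using eigenvalue_root_char_poly[OF A'] A by (auto simp: eigenvalue_def eigenvector_def)
  have vi: "(\<Sum>j<n. complex_of_real (A $$ (i,j)) * v $ j) = a * v $ i" if "i < n" for i
  proof -
    have "(?A *\<^sub>v v) $ i = (a \<cdot>\<^sub>v v) $ i" using v(3) by simp
    then show ?thesis using that v(1) A by (simp add: scalar_prod_def lessThan_atLeast0)
  qed
  define N where "N = (\<Sum>i<n. cnj (v $ i) * v $ i)"
  have Aij: "A $$ (i,j) = A $$ (j,i)" if "i < n" "j < n" for i j
    using sym A that by (metis carrier_matD index_transpose_mat(1))
  define q where "q = (\<Sum>i<n. \<Sum>j<n. cnj (v $ i) * (complex_of_real (A $$ (i,j)) * v $ j))"
  have q: "q = a * N"
  proof -
    have "q = (\<Sum>i<n. cnj (v $ i) * (a * v $ i))"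
      unfolding q_def sum_distrib_left[symmetric] by (intro sum.cong) (auto simp: vi)
    then show ?thesis by (simp add: N_def sum_distrib_left mult_ac)
  qed
  have "cnj q = (\<Sum>i<n. \<Sum>j<n. v $ i * (complex_of_real (A $$ (i,j)) * cnj (v $ j)))"
    by (simp add: q_def)
  also have "\<dots> = (\<Sum>j<n. \<Sum>i<n. v $ i * (complex_of_real (A $$ (i,j)) * cnj (v $ j)))"
    by (rule sum.swap)
  also have "\<dots> = q"
    unfolding q_def by (intro sum.cong) (auto simp: Aij)
  finally have cq: "cnj q = q" .
  have "cnj N = N" by (simp add: N_def mult.commute)
  have N: "N = complex_of_real (\<Sum>i<n. (cmod (v $ i))^2)"
    unfolding N_def of_real_sum complex_norm_square by (simp add: mult.commute)
  have "N \<noteq> 0"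
  proof
    assume "N = 0"
    then have "(\<Sum>i<n. (cmod (v $ i))^2) = 0" unfolding N of_real_eq_0_iff .
    then have "\<forall>i<n. v $ i = 0" by (simp add: sum_nonneg_eq_0_iff)
    then show False using v by auto
  qed
  then have "cnj a = a" using cq q \<open>cnj N = N\<close> by simp
  then obtain e where e: "a = complex_of_real e"
    by (metis Reals_cnj_iff Reals_cases)
  have "poly (map_poly complex_of_real (char_poly A)) a = 0"
    using root of_real_hom.char_poly_hom[where 'a = complex, OF A] by simp
  then have "poly (char_poly A) e = 0" unfolding e by simp
  then show ?thesis using eigenvalue_root_char_poly[OF A] by blast
qed

text \<open>For \<open>u = 0\<close> the division by zero makes this the identity, so no case distinction is needed.\<close>

definition householder :: "nat \<Rightarrow> real vec \<Rightarrow> real mat" where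
  "householder n u = mat n n (\<lambda>(i,j). of_bool (i = j) - 2 / (u \<bullet> u) * u $ i * u $ j)"

lemma householder_carrier [simp]: "householder n u \<in> carrier_mat n n"
  by (simp add: householder_def)

lemma householder_sym: "transpose_mat (householder n u) = householder n u"
  by (rule eq_matI) (auto simp: householder_def)

lemma householder_involution:
  assumes u: "u \<in> carrier_vec n"
  shows "householder n u * householder n u = 1\<^sub>m n"
proof (rule eq_matI)
  fix i j assume "i < dim_row (1\<^sub>m n)" "j < dim_col (1\<^sub>m n)"
  then have ij: "i < n" "j < n" by auto
  define k where "k = 2 / (u \<bullet> u)"
  have uu: "(\<Sum>l<n. u $ l * u $ l) = u \<bullet> u" using u by (simp add: scalar_prod_def lessThan_atLeast0)
  have "(householder n u * householder n u) $$ (i, j) =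
     (\<Sum>l<n. (of_bool (i = l) - k * u $ i * u $ l) * (of_bool (l = j) - k * u $ l * u $ j))"
    using ij by (simp add: householder_def scalar_prod_def lessThan_atLeast0 k_def)
  also have "\<dots> = (\<Sum>l<n. (if l = i then of_bool (i = j) else 0) - (if l = i then k * u $ i * u $ j else 0)
        - (if l = j then k * u $ i * u $ j else 0) + k^2 * u $ i * u $ j * (u $ l * u $ l))"
    by (intro sum.cong) (auto simp: power2_eq_square algebra_simps)
  also have "\<dots> = of_bool (i = j) - k * u $ i * u $ j - k * u $ i * u $ j + k^2 * u $ i * u $ j * (u \<bullet> u)"
    using ij by (simp only: sum.distrib sum_subtractf sum_distrib_left[symmetric] uu) simp
  also have "k^2 * u $ i * u $ j * (u \<bullet> u) = 2 * k * u $ i * u $ j"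
    by (simp add: k_def power2_eq_square)
  finally show "(householder n u * householder n u) $$ (i, j) = 1\<^sub>m n $$ (i, j)"
    using ij by simp
qed (auto simp: householder_def)

text \<open>As w and the first unit vector have equal length, reflection along their difference u
  exchanges them; in coordinates, u \<bullet> u = - 2 u_0.\<close>

lemma householder_col_0:
  assumes w: "w \<in> carrier_vec n" "w \<bullet> w = 1" and n: "n > 0"
  shows "col (householder n (w - unit_vec n 0)) 0 = w"
proof (rule eq_vecI)
  define u where "u = w - unit_vec n 0"
  have u: "u \<in> carrier_vec n" using w by (simp add: u_def)
  have ui: "u $ i = w $ i - of_bool (i = 0)" if "i < n" for i
    using that w n by (auto simp: u_def)
  have ww: "(\<Sum>l<n. w $ l * w $ l) = 1" using w by (simp add: scalar_prod_def lessThan_atLeast0)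
  have "u \<bullet> u = (\<Sum>l<n. w $ l * w $ l + (if l = 0 then 1 - 2 * w $ 0 else 0))"
    using u unfolding scalar_prod_def lessThan_atLeast0[symmetric]
    by (intro sum.cong) (auto simp: ui algebra_simps)
  also have "\<dots> = 2 - 2 * w $ 0"
    using n by (simp only: sum.distrib ww) simp
  finally have uu: "u \<bullet> u = - 2 * u $ 0" using ui[OF n] by simp
  fix i assume "i < dim_vec w"
  then have i: "i < n" using w by simp
  \<comment> \<open>Covers w equal to the unit vector, where the quotient by
    \<open>u \<bullet> u\<close> is a division by zero.\<close>
  have "u $ i = 0" if "u $ 0 = 0"
  proof -
    have "(\<Sum>l<n. u $ l * u $ l) = 0" using uu that u by (simp add: scalar_prod_def lessThan_atLeast0)
    then show ?thesis using i by (simp add: sum_nonneg_eq_0_iff)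
  qed
  then have "2 / (u \<bullet> u) * u $ i * u $ 0 = - u $ i"
    unfolding uu by (cases "u $ 0 = 0") auto
  then show "col (householder n (w - unit_vec n 0)) 0 $ i = w $ i"
    using i n ui[OF i] unfolding u_def[symmetric] by (simp add: householder_def)
qed (use w in \<open>simp add: householder_def\<close>)

text \<open>Deflation: a Householder matrix H carries the first unit vector to a unit eigenvector,
  so the first column of H A H is a multiple of that unit vector, and by symmetry so is the first
  row. The remaining block is symmetric and one size smaller.\<close>

lemma real_symmetric_diagonalization:
  fixes A :: "real mat"
  assumes "A \<in> carrier_mat n n" and "transpose_mat A = A"
  shows "\<exists>W D. W \<in> carrier_mat n n \<and> D \<in> carrier_mat n n \<and> diagonal_mat D \<and>
    transpose_mat W * W = 1\<^sub>m n \<and> A = W * D * transpose_mat W"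
  using assms
proof (induction n arbitrary: A)
  case 0
  then show ?case by (intro exI[of _ A]) (auto simp: diagonal_mat_def)
next
  case (Suc m)
  let ?n = "Suc m"
  note A = Suc.prems(1) and sym = Suc.prems(2)
  obtain e v where v: "v \<in> carrier_vec ?n" "v \<noteq> 0\<^sub>v ?n" "A *\<^sub>v v = e \<cdot>\<^sub>v v"
    using real_symmetric_eigenvalue[OF A sym] A by (auto simp: eigenvalue_def eigenvector_def)
  have vv: "v \<bullet> v > 0"
    using v(1,2) conjugate_square_greater_0_vec[of v ?n] by simp
  define w where "w = (1 / sqrt (v \<bullet> v)) \<cdot>\<^sub>v v"
  have w: "w \<in> carrier_vec ?n" using v by (simp add: w_def)
  have ww: "w \<bullet> w = 1" using v vv by (simp add: w_def)
  have Aw: "A *\<^sub>v w = e \<cdot>\<^sub>v w"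
    using v A by (simp add: w_def mult_mat_vec smult_smult_assoc mult.commute)
  define H where "H = householder ?n (w - unit_vec ?n 0)"
  have H: "H \<in> carrier_mat ?n ?n" "transpose_mat H = H" "H * H = 1\<^sub>m ?n" "col H 0 = w"
    using w ww by (auto simp: H_def householder_sym householder_involution householder_col_0)
  define A' where "A' = H * A * H"
  have A': "A' \<in> carrier_mat ?n ?n" using H A by (simp add: A'_def)
  have symA': "transpose_mat A' = A'"
    using H A sym by (simp add: A'_def transpose_mult[of _ ?n ?n _ ?n] assoc_mult_mat[of _ ?n ?n _ ?n _ ?n])
  have Hw: "H *\<^sub>v w = unit_vec ?n 0"
  proof -
    have "H *\<^sub>v w = col (H * H) 0" unfolding H(4)[symmetric] using col_mult2[OF H(1) H(1), of 0] by simp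
    then show ?thesis unfolding H(3) by simp
  qed
  have colA': "col A' 0 = e \<cdot>\<^sub>v unit_vec ?n 0"
  proof -
    have "col A' 0 = (H * A) *\<^sub>v w"
      unfolding A'_def using col_mult2[of "H * A" ?n ?n H ?n 0] H A by simp
    also have "\<dots> = e \<cdot>\<^sub>v (H *\<^sub>v w)" using H A w Aw by (simp add: assoc_mult_mat_vec[of _ ?n ?n _ ?n] mult_mat_vec)
    finally show ?thesis unfolding Hw .
  qed
  have A'0: "A' $$ (i, 0) = (if i = 0 then e else 0)" if "i < ?n" for i
    using arg_cong[OF colA', of "\<lambda>x. x $ i"] that A' by simp
  have A'0': "A' $$ (0, i) = (if i = 0 then e else 0)" if "i < ?n" for i
    using A'0[OF that] symA' A' that by (metis carrier_matD index_transpose_mat(1) zero_less_Suc)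
  define A3 where "A3 = mat m m (\<lambda>(i,j). A' $$ (Suc i, Suc j))"
  have A3: "A3 \<in> carrier_mat m m" by (simp add: A3_def)
  have "transpose_mat A3 = A3"
  proof (rule eq_matI)
    fix i j assume "i < dim_row A3" "j < dim_col A3"
    then have ij: "Suc i < ?n" "Suc j < ?n" by (auto simp: A3_def)
    have "A' $$ (Suc j, Suc i) = A' $$ (Suc i, Suc j)"
      using symA' A' ij by (metis carrier_matD index_transpose_mat(1))
    then show "transpose_mat A3 $$ (i, j) = A3 $$ (i, j)" using ij by (simp add: A3_def)
  qed (auto simp: A3_def)
  from Suc.IH[OF A3 this] obtain W3 D3 where W3: "W3 \<in> carrier_mat m m" "D3 \<in> carrier_mat m m"
    "diagonal_mat D3" "transpose_mat W3 * W3 = 1\<^sub>m m" "A3 = W3 * D3 * transpose_mat W3" by blast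
  define E where "E = mat 1 1 (\<lambda>_. e)"
  have E: "E \<in> carrier_mat 1 1" by (simp add: E_def)
  define V where "V = four_block_mat (1\<^sub>m 1) (0\<^sub>m 1 m) (0\<^sub>m m 1) W3"
  define D where "D = four_block_mat E (0\<^sub>m 1 m) (0\<^sub>m m 1) D3"
  have V: "V \<in> carrier_mat ?n ?n" and D: "D \<in> carrier_mat ?n ?n"
    using W3 E unfolding V_def D_def by (auto intro!: four_block_carrier_mat[of _ 1 1 _ m m, simplified])
  have Vt: "transpose_mat V = four_block_mat (1\<^sub>m 1) (0\<^sub>m 1 m) (0\<^sub>m m 1) (transpose_mat W3)"
    unfolding V_def using W3 by (subst transpose_four_block_mat[where ?nr1.0 = 1 and ?nc1.0 = 1 and ?nr2.0 = m and ?nc2.0 = m]) (auto simp: transpose_one)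
  have VtV: "transpose_mat V * V = 1\<^sub>m ?n"
  proof -
    have "transpose_mat V * V = four_block_mat (1\<^sub>m 1) (0\<^sub>m 1 m) (0\<^sub>m m 1) (1\<^sub>m m)"
      unfolding Vt unfolding V_def using W3 by (subst mult_four_block_mat[where ?nr1.0 = 1 and ?n1.0 = 1 and ?n2.0 = m and ?nr2.0 = m and ?nc1.0 = 1 and ?nc2.0 = m]) auto
    then show ?thesis by (simp add: one_mat_def four_block_mat_def) (auto intro!: eq_matI)
  qed
  have A'V: "A' = V * D * transpose_mat V"
  proof -
    have VD: "V * D = four_block_mat E (0\<^sub>m 1 m) (0\<^sub>m m 1) (W3 * D3)"
      unfolding V_def D_def using W3 E by (subst mult_four_block_mat[where ?nr1.0 = 1 and ?n1.0 = 1 and ?n2.0 = m and ?nr2.0 = m and ?nc1.0 = 1 and ?nc2.0 = m]) auto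
    have "V * D * transpose_mat V = four_block_mat E (0\<^sub>m 1 m) (0\<^sub>m m 1) A3"
      unfolding VD Vt W3(5) using W3 E by (subst mult_four_block_mat[where ?nr1.0 = 1 and ?n1.0 = 1 and ?n2.0 = m and ?nr2.0 = m and ?nc1.0 = 1 and ?nc2.0 = m]) auto
    also have "\<dots> = A'"
    proof (rule eq_matI)
      fix i j assume "i < dim_row A'" "j < dim_col A'"
      then have "i < ?n" "j < ?n" using A' by auto
      then show "four_block_mat E (0\<^sub>m 1 m) (0\<^sub>m m 1) A3 $$ (i, j) = A' $$ (i, j)"
        using A'0[of i] A'0'[of j] by (auto simp: four_block_mat_def E_def A3_def)
    qed (use A' in \<open>auto simp: E_def A3_def\<close>)
    finally show ?thesis ..
  qed
  have diag: "diagonal_mat D"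
    unfolding diagonal_mat_def
  proof (intro allI impI)
    fix i j assume "i < dim_row D" "j < dim_col D" "i \<noteq> j"
    then show "D $$ (i, j) = 0"
      using W3(2,3) E by (auto simp: D_def four_block_mat_def diagonal_mat_def)
  qed
  note assoc = assoc_mult_mat[of _ ?n ?n _ ?n _ ?n]
  have "A = H * A' * H"
  proof -
    have "H * A' * H = (H * H) * A * (H * H)"
      using H(1) A by (simp add: A'_def assoc)
    then show ?thesis using A unfolding H(3) by simp
  qed
  also have "\<dots> = (H * V) * D * transpose_mat (H * V)"
    unfolding A'V using H V D by (simp add: assoc transpose_mult[of _ ?n ?n _ ?n])
  finally have AA: "A = (H * V) * D * transpose_mat (H * V)" .
  have HHV: "H * (H * V) = V" using assoc_mult_mat[OF H(1) H(1) V] H(3) V by simp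
  have "transpose_mat (H * V) * (H * V) = transpose_mat V * (H * (H * V))"
    using H(1,2) V by (simp add: assoc transpose_mult[of _ ?n ?n _ ?n])
  also have "\<dots> = 1\<^sub>m ?n" unfolding HHV by (rule VtV)
  finally show ?case using AA H V D diag by (intro exI[of _ "H * V"] exI[of _ D]) auto
qed

text \<open>Stated for positions, not values, so that a multiple eigenvalue counts with its
  multiplicity. The number of entries that are at least \<theta> depends only on the
  multiset.\<close>

lemma second_largest_unique:
  fixes ds :: "real list"
  assumes "rev (sorted_list_of_multiset (mset ds)) ! 1 < \<theta>"
    and "i < length ds" "j < length ds" "ds ! i \<ge> \<theta>" "ds ! j \<ge> \<theta>"
  shows "i = j"
proof -
  define L where "L = rev (sort ds)"
  have L: "L ! 1 < \<theta>" "mset L = mset ds" "sorted (rev L)"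
    using assms(1) by (simp_all add: L_def)
  have "{k. k < length L \<and> L ! k \<ge> \<theta>} \<subseteq> {0}"
  proof safe
    fix k assume k: "k < length L" "L ! k \<ge> \<theta>"
    show "k = 0"
    proof (rule ccontr)
      assume "k \<noteq> 0"
      then have "L ! k \<le> L ! 1"
        using sorted_rev_nth_mono[OF L(3), of 1 k] k(1) by simp
      then show False using L(1) k(2) by simp
    qed
  qed
  then have "card {k. k < length L \<and> L ! k \<ge> \<theta>} \<le> 1"
    using card_mono[of "{0::nat}"] by fastforce
  moreover have "card {k. k < length L \<and> L ! k \<ge> \<theta>} = card {k. k < length ds \<and> ds ! k \<ge> \<theta>}"
    using L(2) by (metis length_filter_conv_card mset_filter size_mset)
  ultimately have "card {k. k < length ds \<and> ds ! k \<ge> \<theta>} \<le> Suc 0" by simp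
  then show ?thesis
    using assms(2-5) by (subst (asm) card_le_Suc0_iff_eq) auto
qed

lemma proots_prod_linear: "proots (\<Prod>a\<leftarrow>as. [:- a, 1:]) = mset (as :: real list)"
proof (induction as)
  case (Cons a as)
  have "(\<Prod>a\<leftarrow>as. [:- a, 1:]) \<noteq> 0" by (auto simp: prod_list_zero_iff)
  then show ?case using Cons by (simp add: proots_mult del: mult_pCons_left)
qed simp

text \<open>
  Courant--Fischer: a plane contains a nonzero vector orthogonal to the eigenvector of the only
  eigenvalue that may be at least \<open>\<theta>\<close>.
\<close>

lemma second_eigenvalue_ge:
  fixes A :: "real mat" and \<theta> :: real
  assumes A: "A \<in> carrier_mat n n" and sym: "transpose_mat A = A"
    and xy: "x \<in> carrier_vec n" "y \<in> carrier_vec n"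
    and plane: "\<And>a b z. a \<noteq> 0 \<or> b \<noteq> 0 \<Longrightarrow> z = a \<cdot>\<^sub>v x + b \<cdot>\<^sub>v y \<Longrightarrow>
      z \<noteq> 0\<^sub>v n \<and> z \<bullet> (A *\<^sub>v z) \<ge> \<theta> * (z \<bullet> z)"
  shows "rev (sorted_list_of_multiset (proots (char_poly A))) ! 1 \<ge> \<theta>"
proof (rule ccontr)
  assume "\<not> ?thesis"
  then have less: "rev (sorted_list_of_multiset (proots (char_poly A))) ! 1 < \<theta>" by simp
  obtain W D where W: "W \<in> carrier_mat n n" and D: "D \<in> carrier_mat n n" "diagonal_mat D"
    and WtW: "transpose_mat W * W = 1\<^sub>m n" and AW: "A = W * D * transpose_mat W"
    using real_symmetric_diagonalization[OF A sym] by blast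
  have WWt: "W * transpose_mat W = 1\<^sub>m n"
    using mat_mult_left_right_inverse[OF _ W WtW] W by simp
  have "similar_mat A D"
    unfolding similar_mat_def
    by (intro exI[of _ W] exI[of _ "transpose_mat W"] similar_mat_witI[OF WWt WtW AW])
      (use A D W in auto)
  then have "char_poly A = char_poly D" by (rule char_poly_similar)
  also have "\<dots> = (\<Prod>a\<leftarrow>diag_mat D. [:- a, 1:])"
    using D by (intro char_poly_upper_triangular[of _ n]) (auto simp: diagonal_mat_def)
  finally have roots: "proots (char_poly A) = mset (diag_mat D)" by (simp add: proots_prod_linear)
  define ds where "ds = diag_mat D"
  have ds: "length ds = n" "\<And>i. i < n \<Longrightarrow> ds ! i = D $$ (i,i)"
    using D by (auto simp: ds_def diag_mat_def)
  have unique: "i = j" if "i < n" "j < n" "ds ! i \<ge> \<theta>" "ds ! j \<ge> \<theta>" for i j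
    using second_largest_unique[of ds \<theta> i j] less that unfolding roots ds_def[symmetric] ds(1) by blast
  \<comment> \<open>If no eigenvalue reaches \<theta>, \<open>i0\<close> is arbitrary and may lie
    out of range; hence the condition on \<open>i0\<close> in \<open>c0\<close>.\<close>
  obtain i0 where i0: "\<And>j. j < n \<Longrightarrow> j \<noteq> i0 \<Longrightarrow> ds ! j < \<theta>"
    by (metis unique not_less)
  let ?c = "\<lambda>z. transpose_mat W *\<^sub>v z"
  \<comment> \<open>One homogeneous linear equation in two unknowns.\<close>
  obtain a b :: real where ab: "a \<noteq> 0 \<or> b \<noteq> 0" "a * ?c x $ i0 + b * ?c y $ i0 = 0"
  proof (cases "?c x $ i0 = 0 \<and> ?c y $ i0 = 0")
    case True
    then show ?thesis using that[of 1 0] by simp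
  next
    case False
    then show ?thesis using that[of "?c y $ i0" "- ?c x $ i0"] by auto
  qed
  define z where "z = a \<cdot>\<^sub>v x + b \<cdot>\<^sub>v y"
  define c where "c = ?c z"
  have z: "z \<in> carrier_vec n" using xy by (simp add: z_def)
  have c: "c \<in> carrier_vec n" using z W by (simp add: c_def)
  have zc: "z = W *\<^sub>v c"
    using assoc_mult_mat_vec[of W n n "transpose_mat W" n z] W WWt z by (simp add: c_def)
  have c0: "c $ i0 = 0" if "i0 < n"
  proof -
    have "c = a \<cdot>\<^sub>v ?c x + b \<cdot>\<^sub>v ?c y"
      using xy W by (simp add: c_def z_def mult_add_distrib_mat_vec[of _ n n] mult_mat_vec[of _ n n])
    then show ?thesis using ab(2) that W xy by simp
  qed
  have adj: "(W *\<^sub>v r) \<bullet> s = r \<bullet> (?c s)" if "r \<in> carrier_vec n" "s \<in> carrier_vec n" for r s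
    using transpose_vec_mult_scalar[OF W that] that W
    by (metis comm_scalar_prod mult_mat_vec_carrier transpose_carrier_mat)
  have "z \<bullet> z = c \<bullet> c" using adj[OF c z, folded zc c_def] .
  then have zz: "z \<bullet> z = (\<Sum>i<n. c $ i * c $ i)"
    using c by (simp add: scalar_prod_def lessThan_atLeast0)
  have "A *\<^sub>v z = W *\<^sub>v (D *\<^sub>v c)"
    unfolding AW c_def using W D z
    by (simp add: assoc_mult_mat_vec[of _ n n _ n])
  moreover have "z \<bullet> (A *\<^sub>v z) = c \<bullet> (?c (A *\<^sub>v z))"
    using adj[OF c, of "A *\<^sub>v z", folded zc] A z by simp
  ultimately have "z \<bullet> (A *\<^sub>v z) = c \<bullet> (?c (W *\<^sub>v (D *\<^sub>v c)))" by simp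
  also have "?c (W *\<^sub>v (D *\<^sub>v c)) = D *\<^sub>v c"
    using assoc_mult_mat_vec[of "transpose_mat W" n n W n "D *\<^sub>v c"] W WtW D c by simp
  also have "D *\<^sub>v c = vec n (\<lambda>i. ds ! i * c $ i)"
  proof (rule eq_vecI)
    fix i assume "i < dim_vec (vec n (\<lambda>i. ds ! i * c $ i))"
    then have i: "i < n" by simp
    have "(D *\<^sub>v c) $ i = (\<Sum>j<n. D $$ (i,j) * c $ j)"
      using i D c by (simp add: scalar_prod_def lessThan_atLeast0)
    also have "\<dots> = (\<Sum>j<n. if j = i then ds ! i * c $ i else 0)"
      by (intro sum.cong) (use i D ds in \<open>auto simp: diagonal_mat_def\<close>)
    finally show "(D *\<^sub>v c) $ i = vec n (\<lambda>i. ds ! i * c $ i) $ i" using i by simp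
  qed (use D in simp)
  finally have zAz: "z \<bullet> (A *\<^sub>v z) = (\<Sum>i<n. ds ! i * (c $ i * c $ i))"
    by (simp add: scalar_prod_def lessThan_atLeast0 mult_ac)
  from plane[OF ab(1) z_def] have z0: "z \<noteq> 0\<^sub>v n" and ge: "z \<bullet> (A *\<^sub>v z) \<ge> \<theta> * (z \<bullet> z)" by auto
  have "\<exists>i<n. c $ i \<noteq> 0"
  proof (rule ccontr)
    assume "\<not> ?thesis"
    then have "c = 0\<^sub>v n" using c by auto
    then have "z = 0\<^sub>v n" using zc W by auto
    then show False using z0 by simp
  qed
  then obtain i where i: "i < n" "c $ i \<noteq> 0" by blast
  \<comment> \<open>Every eigenvalue that contributes to z is below \<theta>, and z has a nonzero
    coordinate, so the inequality is strict.\<close>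
  have "z \<bullet> (A *\<^sub>v z) < (\<Sum>i<n. \<theta> * (c $ i * c $ i))"
    unfolding zAz
  proof (rule sum_strict_mono_ex1)
    have "ds ! j * (c $ j * c $ j) \<le> \<theta> * (c $ j * c $ j)" if "j < n" for j
      using i0[OF that] c0 that by (cases "j = i0") (auto intro!: mult_right_mono)
    then show "\<forall>j\<in>{..<n}. ds ! j * (c $ j * c $ j) \<le> \<theta> * (c $ j * c $ j)" by simp
    have "i \<noteq> i0" using c0 i by auto
    then have "ds ! i * (c $ i * c $ i) < \<theta> * (c $ i * c $ i)"
      using i0[OF i(1)] i(2) by (intro mult_strict_right_mono) (auto simp: zero_less_mult_iff linorder_neq_iff)
    then show "\<exists>j\<in>{..<n}. ds ! j * (c $ j * c $ j) < \<theta> * (c $ j * c $ j)" using i by blast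
  qed simp
  also have "\<dots> = \<theta> * (z \<bullet> z)" unfolding zz sum_distrib_left ..
  finally show False using ge by simp
qed


subsection \<open>Components left by a vertex cut\<close>

lemma sum_nth_distinct:
  assumes "distinct vs"
  shows "(\<Sum>i<length vs. f (vs ! i)) = (\<Sum>v\<in>set vs. f v)"
  using sum.reindex_bij_betw[OF bij_betw_nth[OF assms refl refl], of f] .

lemma quad_scale: "quad C E (\<lambda>v. a * y v) = a^2 * quad C E y"
  by (simp add: quad_def sum_distrib_left power2_eq_square mult_ac)

lemma quad_cong: "(\<And>v. v \<in> C \<Longrightarrow> y v = z v) \<Longrightarrow> quad C E y = quad C E z"
  by (simp add: quad_def)

lemma quad_Un:
  assumes "finite C1" "finite C2" "C1 \<inter> C2 = {}"
    and "\<And>u v. u \<in> C1 \<Longrightarrow> v \<in> C2 \<Longrightarrow> \<not> E u v \<and> \<not> E v u"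
  shows "quad (C1 \<union> C2) E y = quad C1 E y + quad C2 E y"
proof -
  have "(\<Sum>v\<in>C1 \<union> C2. of_bool (E u v) * (y u * y v)) = (\<Sum>v\<in>C1. of_bool (E u v) * (y u * y v))"
    if "u \<in> C1" for u
    by (intro sum.mono_neutral_right) (use assms that in auto)
  moreover have "(\<Sum>v\<in>C1 \<union> C2. of_bool (E u v) * (y u * y v)) = (\<Sum>v\<in>C2. of_bool (E u v) * (y u * y v))"
    if "u \<in> C2" for u
    by (intro sum.mono_neutral_right) (use assms that in auto)
  ultimately show ?thesis
    unfolding quad_def sum.union_disjoint[OF assms(1-3)] by (intro arg_cong2[of _ _ _ _ "(+)"] sum.cong) auto
qed

lemma quad_mono_neutral:
  assumes "finite V" "C \<subseteq> V" "\<And>v. v \<in> V - C \<Longrightarrow> y v = 0"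
  shows "quad V E y = quad C E y"
proof -
  have "quad V E y = (\<Sum>u\<in>V. \<Sum>v\<in>C. of_bool (E u v) * (y u * y v))"
    unfolding quad_def
    by (intro sum.cong sum.mono_neutral_right) (use assms in auto)
  also have "\<dots> = quad C E y"
    unfolding quad_def
    by (intro sum.mono_neutral_right) (use assms in auto)
  finally show ?thesis .
qed

section \<open>From test vectors on two vertex sets to the second eigenvalue\<close>

context graph
begin

lemma dominates_sym: "u \<rightarrow>\<^bsub>G\<^esub> v \<Longrightarrow> v \<rightarrow>\<^bsub>G\<^esub> u"
  using arcs_ends_symmetric[OF sym_arcs] .

lemma out_degree_eq_card: "out_degree G v = card {u \<in> verts G. v \<rightarrow>\<^bsub>G\<^esub> u}"
proof -
  have "bij_betw (head G) (out_arcs G v) {u \<in> verts G. v \<rightarrow>\<^bsub>G\<^esub> u}"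
    unfolding bij_betw_def
  proof
    show "inj_on (head G) (out_arcs G v)"
      using no_multi_arcs by (auto simp: inj_on_def arc_to_ends_def)
    show "head G ` out_arcs G v = {u \<in> verts G. v \<rightarrow>\<^bsub>G\<^esub> u}"
      by (auto simp: arcs_ends_conv image_iff)
  qed
  then show ?thesis unfolding out_degree_def by (rule bij_betw_same_card)
qed

lemma vertex_enumeration: "distinct (vertex_enumeration G)" "set (vertex_enumeration G) = verts G"
proof -
  have "\<exists>vs. distinct vs \<and> set vs = verts G"
    using finite_distinct_list[OF finite_verts] by auto
  from someI_ex[OF this]
  show "distinct (vertex_enumeration G)" "set (vertex_enumeration G) = verts G"
    unfolding vertex_enumeration_def by auto
qed

text \<open>Extended by zero, the two test vectors have disjoint supports with no edge between them,
  so norm and form of a x + b y split into an a^2 part and a b^2 part without cross terms.\<close>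

lemma graph_lambda_2_ge:
  assumes C: "C1 \<subseteq> verts G" "C2 \<subseteq> verts G" "C1 \<inter> C2 = {}"
    and sep: "\<And>u v. u \<in> C1 \<Longrightarrow> v \<in> C2 \<Longrightarrow> \<not> u \<rightarrow>\<^bsub>G\<^esub> v"
    and ray: "rayleigh_ge C1 (\<lambda>u v. u \<rightarrow>\<^bsub>G\<^esub> v) \<theta>" "rayleigh_ge C2 (\<lambda>u v. u \<rightarrow>\<^bsub>G\<^esub> v) \<theta>"
  shows "graph_lambda 2 G \<ge> \<theta>"
proof -
  let ?E = "\<lambda>u v. u \<rightarrow>\<^bsub>G\<^esub> v"
  define vs where "vs = vertex_enumeration G"
  have vs: "distinct vs" "set vs = verts G" using vertex_enumeration by (simp_all add: vs_def)
  define n where "n = length vs"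
  define A where "A = adjacency_matrix G vs"
  have A: "A \<in> carrier_mat n n" by (simp add: A_def adjacency_matrix_def n_def)
  have Aij: "A $$ (i,j) = of_bool (vs ! i \<rightarrow>\<^bsub>G\<^esub> vs ! j)" if "i < n" "j < n" for i j
    using that by (simp add: A_def adjacency_matrix_def n_def)
  have sym: "transpose_mat A = A"
    by (rule eq_matI) (use A Aij dominates_sym in \<open>auto simp: of_bool_def\<close>)
  define vect where "vect y = vec n (\<lambda>i. y (vs ! i))" for y :: "'a \<Rightarrow> real"
  have vect: "vect y \<in> carrier_vec n" for y by (simp add: vect_def)
  have sums: "(\<Sum>i<n. f (vs ! i)) = (\<Sum>v\<in>verts G. f v)" for f :: "'a \<Rightarrow> real"
    using sum_nth_distinct[OF vs(1), of f] by (simp add: n_def vs)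
  have norm: "vect y \<bullet> vect y = (\<Sum>v\<in>verts G. y v ^ 2)" for y
    using sums[of "\<lambda>v. y v * y v"]
    by (simp add: vect_def scalar_prod_def lessThan_atLeast0 power2_eq_square)
  have form: "vect y \<bullet> (A *\<^sub>v vect y) = quad (verts G) ?E y" for y
  proof -
    have "(A *\<^sub>v vect y) $ i = (\<Sum>v\<in>verts G. of_bool (vs ! i \<rightarrow>\<^bsub>G\<^esub> v) * y v)" if "i < n" for i
      using that A sums[of "\<lambda>v. of_bool (vs ! i \<rightarrow>\<^bsub>G\<^esub> v) * y v"]
      by (simp add: scalar_prod_def lessThan_atLeast0 vect_def Aij)
    then have "vect y \<bullet> (A *\<^sub>v vect y) = (\<Sum>i<n. y (vs ! i) * (\<Sum>v\<in>verts G. of_bool (vs ! i \<rightarrow>\<^bsub>G\<^esub> v) * y v))"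
      using A by (simp add: scalar_prod_def lessThan_atLeast0 vect_def)
    also have "\<dots> = (\<Sum>u\<in>verts G. y u * (\<Sum>v\<in>verts G. of_bool (u \<rightarrow>\<^bsub>G\<^esub> v) * y v))"
      by (rule sums)
    also have "\<dots> = quad (verts G) ?E y"
      unfolding quad_def sum_distrib_left by (intro sum.cong refl) (rule mult.left_commute)
    finally show ?thesis .
  qed
  have fin: "finite C1" "finite C2" using C finite_subset[OF _ finite_verts] by auto
  obtain y1 where y1: "\<exists>v\<in>C1. y1 v \<noteq> 0" "quad C1 ?E y1 \<ge> \<theta> * (\<Sum>v\<in>C1. y1 v ^ 2)"
    using ray(1) unfolding rayleigh_ge_def by blast
  obtain y2 where y2: "\<exists>v\<in>C2. y2 v \<noteq> 0" "quad C2 ?E y2 \<ge> \<theta> * (\<Sum>v\<in>C2. y2 v ^ 2)"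
    using ray(2) unfolding rayleigh_ge_def by blast
  define x where "x = vect (\<lambda>v. if v \<in> C1 then y1 v else 0)"
  define y where "y = vect (\<lambda>v. if v \<in> C2 then y2 v else 0)"
  have "rev (sorted_list_of_multiset (proots (char_poly A))) ! 1 \<ge> \<theta>"
  proof (rule second_eigenvalue_ge[OF A sym])
    show "x \<in> carrier_vec n" "y \<in> carrier_vec n" by (simp_all add: x_def y_def vect)
  next
    fix a b :: real and z
    assume ab: "a \<noteq> 0 \<or> b \<noteq> 0" and z: "z = a \<cdot>\<^sub>v x + b \<cdot>\<^sub>v y"
    define w where "w v = (if v \<in> C1 then a * y1 v else if v \<in> C2 then b * y2 v else 0)" for v
    have zw: "z = vect w"
      unfolding z x_def y_def vect_def by (rule eq_vecI) (use C in \<open>auto simp: w_def\<close>)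
    have w1: "w v = a * y1 v" if "v \<in> C1" for v using that by (simp add: w_def)
    have w2: "w v = b * y2 v" if "v \<in> C2" for v using that C by (auto simp: w_def)
    have "(\<Sum>v\<in>verts G. w v ^ 2) = (\<Sum>v\<in>C1 \<union> C2. w v ^ 2)"
      by (intro sum.mono_neutral_right) (use C in \<open>auto simp: w_def\<close>)
    also have "\<dots> = a^2 * (\<Sum>v\<in>C1. y1 v ^ 2) + b^2 * (\<Sum>v\<in>C2. y2 v ^ 2)"
      using fin C by (simp add: sum.union_disjoint w1 w2 power_mult_distrib sum_distrib_left)
    finally have zz: "z \<bullet> z = a^2 * (\<Sum>v\<in>C1. y1 v ^ 2) + b^2 * (\<Sum>v\<in>C2. y2 v ^ 2)"
      unfolding zw norm .
    have "quad (verts G) ?E w = quad (C1 \<union> C2) ?E w"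
      by (rule quad_mono_neutral) (use C in \<open>auto simp: w_def\<close>)
    also have "\<dots> = quad C1 ?E w + quad C2 ?E w"
      by (rule quad_Un) (use fin C sep in \<open>auto dest: dominates_sym\<close>)
    also have "quad C1 ?E w = a^2 * quad C1 ?E y1"
      unfolding quad_scale[symmetric] by (rule quad_cong) (rule w1)
    also have "quad C2 ?E w = b^2 * quad C2 ?E y2"
      unfolding quad_scale[symmetric] by (rule quad_cong) (rule w2)
    finally have zAz: "z \<bullet> (A *\<^sub>v z) = a^2 * quad C1 ?E y1 + b^2 * quad C2 ?E y2"
      unfolding zw form .
    have "\<theta> * (z \<bullet> z) = a^2 * (\<theta> * (\<Sum>v\<in>C1. y1 v ^ 2)) + b^2 * (\<theta> * (\<Sum>v\<in>C2. y2 v ^ 2))"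
      unfolding zz by (simp add: algebra_simps)
    also have "\<dots> \<le> z \<bullet> (A *\<^sub>v z)"
      unfolding zAz using y1(2) y2(2) by (intro add_mono mult_left_mono) auto
    finally have "\<theta> * (z \<bullet> z) \<le> z \<bullet> (A *\<^sub>v z)" .
    moreover have "z \<noteq> 0\<^sub>v n"
    proof
      assume "z = 0\<^sub>v n"
      then have "vect w $ i = 0" if "i < n" for i
        using that zw by simp
      then have "w (vs ! i) = 0" if "i < n" for i
        using that by (simp add: vect_def)
      then have w0: "w v = 0" if "v \<in> verts G" for v
        using that vs(2) by (metis in_set_conv_nth n_def)
      from y1(1) y2(1) obtain u v where "u \<in> C1" "y1 u \<noteq> 0" "v \<in> C2" "y2 v \<noteq> 0" by blast
      then show False using ab w1[of u] w2[of v] w0[of u] w0[of v] C by auto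
    qed
    ultimately show "z \<noteq> 0\<^sub>v n \<and> \<theta> * (z \<bullet> z) \<le> z \<bullet> (A *\<^sub>v z)" by simp
  qed
  then show ?thesis
    by (simp add: graph_lambda_def graph_eigenvalues_def A_def vs_def)
qed

end

text \<open>Connected induced subgraphs of a symmetric digraph are strongly connected. This
  transfers finiteness, disjointness and the description by reachability from \<open>sccs\<close> to
  components.\<close>

lemma (in sym_digraph) graph_components_eq_sccs: "graph_components G = sccs"
proof
  have sc: "connected H \<Longrightarrow> strongly_connected H" if "induced_subgraph H G" for H
  proof -
    assume "connected H"
    interpret H: sym_digraph H by (rule induced_graph_imp_graph[OF that])
    show "strongly_connected H"
      using H.symmetric_connected_imp_strongly_connected[OF H.sym_arcs \<open>connected H\<close>] .
  qed
  have sc_imp: "connected H" if "strongly_connected H" for H :: "('a, 'b) pre_digraph"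
    unfolding connected_conv
  proof (intro conjI ballI)
    show "verts H \<noteq> {}" using that by (simp add: strongly_connected_def)
    fix u v assume "u \<in> verts H" "v \<in> verts H"
    then have "(u, v) \<in> rtrancl_on (verts H) (arcs_ends H)"
      using that by (simp add: strongly_connected_def reachable_def)
    then show "(u, v) \<in> rtrancl_on (verts H) ((arcs_ends H)\<^sup>s)"
      by (rule rtrancl_on_mono[rotated 2]) (auto simp: symcl_def)
  qed
  have am: "arc_mono connected"
    unfolding arc_mono_def
    by (metis spanning_def subgraphE wf_digraph.connected_spanning_imp_connected)
  show "graph_components G \<subseteq> sccs"
  proof
    fix H assume "H \<in> graph_components G"
    then have H: "max_subgraph connected H" by (simp add: graph_components_def)
    then have ind: "induced_subgraph H G" using am by (rule induced_subgraphI_arc_mono)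
    have "strongly_connected H" using sc[OF ind] max_subgraph_prop[OF H] .
    then show "H \<in> sccs" unfolding sccs_altdef2 mem_Collect_eq
      using H sc_imp by (auto simp: max_subgraph_def)
  qed
  show "sccs \<subseteq> graph_components G"
  proof
    fix H assume H: "H \<in> sccs"
    then have H': "max_subgraph strongly_connected H" by (simp add: sccs_altdef2)
    have ind: "induced_subgraph H G" using H by (rule in_sccs_imp_induced)
    have sub: "subgraph H G" using ind by (simp add: induced_subgraph_def)
    have "max_subgraph connected H"
    proof (rule max_subgraphI)
      show "connected H" using max_subgraph_prop[OF H'] by (rule sc_imp)
      show "subgraph H G" by (rule sub)
      fix K assume K: "H \<noteq> K" "subgraph H K" "subgraph K G"
      show "\<not> connected K"
      proof
        assume cK: "connected K"
        \<comment> \<open>\<open>K\<close> may contain an arc without its opposite, so strong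
          connectivity is only available for the subgraph induced on its vertices.\<close>
        let ?K = "G \<restriction> verts K"
        have K': "subgraph K ?K" "subgraph ?K G" "induced_subgraph ?K G"
          using K(3) by (auto simp: subgraph_induce_subgraphI2 subgraph_induce_subgraphI induced_induce)
        have "verts K = verts ?K" by simp
        then have "connected ?K" using am K'(1) cK unfolding arc_mono_def by blast
        then have "strongly_connected ?K" by (rule sc[OF K'(3)])
        moreover have "subgraph H ?K" using K(2) K'(1) by (rule subgraph_trans)
        ultimately have "?K = H" using H' K'(2) unfolding max_subgraph_def by metis
        then have "subgraph K H" using K'(1) by simp
        then show False using K(1,2) by (auto simp: subgraph_def compatible_def intro!: pre_digraph.equality)
      qed
    qed
    then show "H \<in> graph_components G" by (simp add: graph_components_def)
  qed
qed

text \<open>Isolates what the edge count uses about the components of G - S: disjoint nonempty sets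
  whose edges lead outside only into S.\<close>

definition separated_family :: "('a, 'b) pre_digraph \<Rightarrow> 'a set \<Rightarrow> 'a set set \<Rightarrow> bool" where
  "separated_family G S \<C> \<longleftrightarrow> disjoint \<C> \<and> (\<forall>C\<in>\<C>. C \<noteq> {} \<and> C \<subseteq> verts G - S \<and>
     (\<forall>u\<in>C. \<forall>v. u \<rightarrow>\<^bsub>G\<^esub> v \<longrightarrow> v \<in> C \<union> S))"

section \<open>Counting edges between a cut and the components\<close>

context graph
begin

text \<open>By regularity, the neighbours a vertex lacks inside \<open>C\<close> all lie in
  \<open>S\<close>; summed over \<open>C\<close>, deficiencies count the edges from \<open>C\<close>
  to \<open>S\<close>.\<close>

lemma separated_family_near_regular:
  assumes "regular_graph d G" and "separated_family G S \<C>" and "C \<in> \<C>"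
  shows "near_regular C (\<lambda>u v. u \<rightarrow>\<^bsub>G\<^esub> v) d"
    and "S \<subseteq> verts G \<Longrightarrow> u \<in> C \<Longrightarrow> deficiency C (\<lambda>u v. u \<rightarrow>\<^bsub>G\<^esub> v) d u = card {v \<in> S. u \<rightarrow>\<^bsub>G\<^esub> v}"
proof -
  have C: "C \<noteq> {}" "C \<subseteq> verts G - S" "\<And>u v. u \<in> C \<Longrightarrow> u \<rightarrow>\<^bsub>G\<^esub> v \<Longrightarrow> v \<in> C \<union> S"
    using assms(2,3) unfolding separated_family_def by auto
  have deg: "card {v \<in> verts G. u \<rightarrow>\<^bsub>G\<^esub> v} = d" if "u \<in> C" for u
    using assms(1) C(2) that out_degree_eq_card[of u] by (auto simp: regular_graph_def)
  show "near_regular C (\<lambda>u v. u \<rightarrow>\<^bsub>G\<^esub> v) d"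
  proof
    show "finite C" using C(2) finite_subset[OF _ finite_verts] by blast
    show "C \<noteq> {}" by (rule C(1))
    show "u \<rightarrow>\<^bsub>G\<^esub> v \<Longrightarrow> v \<rightarrow>\<^bsub>G\<^esub> u" for u v by (rule dominates_sym)
    show "\<not> u \<rightarrow>\<^bsub>G\<^esub> u" for u using adj_not_same by blast
    show "card {v \<in> C. u \<rightarrow>\<^bsub>G\<^esub> v} \<le> d" if "u \<in> C" for u
      unfolding deg[OF that, symmetric] by (rule card_mono) (use C in auto)
  qed
  show "deficiency C (\<lambda>u v. u \<rightarrow>\<^bsub>G\<^esub> v) d u = card {v \<in> S. u \<rightarrow>\<^bsub>G\<^esub> v}"
    if "S \<subseteq> verts G" "u \<in> C"
  proof -
    have fin: "finite C" "finite S" using C(2) that(1) finite_subset[OF _ finite_verts] by blast+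
    have "{v \<in> verts G. u \<rightarrow>\<^bsub>G\<^esub> v} = {v \<in> C. u \<rightarrow>\<^bsub>G\<^esub> v} \<union> {v \<in> S. u \<rightarrow>\<^bsub>G\<^esub> v}"
      using C(2) C(3)[OF that(2)] that(1) by auto
    moreover have "card ({v \<in> C. u \<rightarrow>\<^bsub>G\<^esub> v} \<union> {v \<in> S. u \<rightarrow>\<^bsub>G\<^esub> v}) =
        card {v \<in> C. u \<rightarrow>\<^bsub>G\<^esub> v} + card {v \<in> S. u \<rightarrow>\<^bsub>G\<^esub> v}"
      by (rule card_Un_disjoint) (use C(2) fin in auto)
    ultimately show ?thesis using deg[OF that(2)] by (simp add: deficiency_def)
  qed
qed

lemma boundary_edge_exists:
  assumes conn: "Digraph_Component.connected G" and C: "C \<subseteq> verts G" "C \<noteq> {}" "C \<noteq> verts G"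
  shows "\<exists>u\<in>C. \<exists>v. v \<notin> C \<and> u \<rightarrow>\<^bsub>G\<^esub> v"
proof (rule ccontr)
  assume no: "\<not> ?thesis"
  obtain u w where u: "u \<in> C" and w: "w \<in> verts G" "w \<notin> C" using C by blast
  have "strongly_connected G"
    using symmetric_connected_imp_strongly_connected[OF sym_arcs conn] .
  then have "u \<rightarrow>\<^sup>*\<^bsub>G\<^esub> w" using u w C by (auto simp: strongly_connected_def)
  then have "w \<in> C" using u
    by (induction rule: converse_reachable_induct) (use no in auto)
  then show False using w by simp
qed

text \<open>If all members but one sent at least d/b edges to S, these at least b |S| members would
  already use up all d |S| edge ends at S; the remaining one sends at least one more edge, since G
  is connected.\<close>

lemma two_sparse_components:
  assumes b: "b \<ge> 1" and conn: "Digraph_Component.connected G" and reg: "regular_graph d G"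
    and S: "S \<subseteq> verts G" "S \<noteq> {}" and fam: "separated_family G S \<C>" and fin: "finite \<C>"
    and many: "card \<C> > b * card S"
  shows "\<exists>C1\<in>\<C>. \<exists>C2\<in>\<C>. C1 \<noteq> C2 \<and>
    (\<forall>C\<in>{C1, C2}. b * (\<Sum>u\<in>C. deficiency C (\<lambda>u v. u \<rightarrow>\<^bsub>G\<^esub> v) d u) < d)"
proof (rule ccontr)
  assume no: "\<not> ?thesis"
  define e where "e C = (\<Sum>u\<in>C. deficiency C (\<lambda>u v. u \<rightarrow>\<^bsub>G\<^esub> v) d u)" for C
  have e: "e C = (\<Sum>u\<in>C. card {v \<in> S. u \<rightarrow>\<^bsub>G\<^esub> v})" if "C \<in> \<C>" for C
    unfolding e_def using separated_family_near_regular(2)[OF reg fam that S(1)] by simp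
  have famD: "C \<noteq> {}" "C \<subseteq> verts G - S" "\<And>u v. u \<in> C \<Longrightarrow> u \<rightarrow>\<^bsub>G\<^esub> v \<Longrightarrow> v \<in> C \<union> S" if "C \<in> \<C>" for C
    using fam that unfolding separated_family_def by auto
  have finS: "finite S" using S(1) finite_subset[OF _ finite_verts] by blast
  have finC: "finite C" if "C \<in> \<C>" for C
    using famD(2)[OF that] finite_subset[OF _ finite_verts] by blast
  have total: "(\<Sum>C\<in>\<C>. e C) \<le> d * card S"
  proof -
    have "(\<Sum>C\<in>\<C>. e C) = (\<Sum>u\<in>\<Union>\<C>. card {v \<in> S. u \<rightarrow>\<^bsub>G\<^esub> v})"
      using fam finC by (subst sum.Union_disjoint) (auto simp: separated_family_def disjoint_def e)
    also have "\<dots> \<le> (\<Sum>u\<in>verts G. card {v \<in> S. u \<rightarrow>\<^bsub>G\<^esub> v})"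
      by (rule sum_mono2) (use famD in auto)
    also have "\<dots> = (\<Sum>v\<in>S. card {u \<in> verts G. u \<rightarrow>\<^bsub>G\<^esub> v})"
      by (rule sum_multicount_gen) (use finS in auto)
    also have "\<dots> = (\<Sum>v\<in>S. d)"
    proof (intro sum.cong refl)
      fix v assume "v \<in> S"
      moreover have "{u \<in> verts G. u \<rightarrow>\<^bsub>G\<^esub> v} = {u \<in> verts G. v \<rightarrow>\<^bsub>G\<^esub> u}"
        using dominates_sym by blast
      ultimately show "card {u \<in> verts G. u \<rightarrow>\<^bsub>G\<^esub> v} = d"
        using reg S(1) out_degree_eq_card[of v] by (auto simp: regular_graph_def)
    qed
    finally show ?thesis by (simp add: mult.commute)
  qed
  have pos: "e C \<ge> 1" if C: "C \<in> \<C>" for C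
  proof -
    have "C \<subseteq> verts G" "C \<noteq> verts G" using famD(2)[OF C] S by auto
    then obtain u v where uv: "u \<in> C" "v \<notin> C" "u \<rightarrow>\<^bsub>G\<^esub> v"
      using boundary_edge_exists[OF conn _ famD(1)[OF C]] by blast
    then have "v \<in> {v \<in> S. u \<rightarrow>\<^bsub>G\<^esub> v}" using famD(3)[OF C] by auto
    then have "card {v \<in> S. u \<rightarrow>\<^bsub>G\<^esub> v} > 0" using finS by (auto simp: card_gt_0_iff)
    also have "card {v \<in> S. u \<rightarrow>\<^bsub>G\<^esub> v} \<le> e C"
      unfolding e[OF C] by (rule member_le_sum) (use uv finC[OF C] in auto)
    finally show ?thesis by simp
  qed
  \<comment> \<open>\<open>C0\<close> is the only sparse member if there is one, and an arbitrary
    member otherwise.\<close>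
  have "\<exists>C0\<in>\<C>. \<forall>C\<in>\<C> - {C0}. d \<le> b * e C"
  proof (cases "\<exists>C0\<in>\<C>. b * e C0 < d")
    case True
    then obtain C0 where "C0 \<in> \<C>" "b * e C0 < d" by blast
    moreover have "C1 = C2 \<or> d \<le> b * e C1 \<or> d \<le> b * e C2" if "C1 \<in> \<C>" "C2 \<in> \<C>" for C1 C2
      using no that unfolding e_def[symmetric] by (auto simp: not_less)
    ultimately show ?thesis by (metis DiffE insertCI not_less)
  next
    case False
    moreover have "\<C> \<noteq> {}" using many by auto
    ultimately show ?thesis by (auto simp: not_less)
  qed
  then obtain C0 where C0: "C0 \<in> \<C>" "\<And>C. C \<in> \<C> - {C0} \<Longrightarrow> d \<le> b * e C" by blast
  have "b * card S * d \<le> card (\<C> - {C0}) * d"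
    using many fin C0(1) by (intro mult_right_mono) auto
  also have "\<dots> \<le> (\<Sum>C\<in>\<C> - {C0}. b * e C)"
    using sum_bounded_below[of "\<C> - {C0}" d "\<lambda>C. b * e C"] C0(2) by simp
  also have "\<dots> = b * (\<Sum>C\<in>\<C> - {C0}. e C)" by (simp add: sum_distrib_left)
  finally have "b * (d * card S) \<le> b * (\<Sum>C\<in>\<C> - {C0}. e C)" by (simp add: mult_ac)
  then have "d * card S \<le> (\<Sum>C\<in>\<C> - {C0}. e C)" using b by simp
  also have "\<dots> < (\<Sum>C\<in>\<C>. e C)"
    using pos[OF C0(1)] sum.remove[OF fin C0(1), of e] by simp
  finally show False using total by simp
qed

end

section \<open>Vertex cuts of the graph and the conclusion\<close>

lemma (in graph) graph_delete_vertices: "graph (delete_vertices G S)"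
proof -
  have "induced_subgraph (G \<restriction> (verts G - S)) G" by (rule induced_induce) simp
  interpret D: sym_digraph "G \<restriction> (verts G - S)"
    by (rule induced_graph_imp_graph) fact
  show ?thesis
    unfolding delete_vertices_def
    by unfold_locales (use no_loops no_multi_arcs in \<open>auto simp: arc_to_ends_def\<close>)
qed

lemma (in graph) num_components_eq:
  "num_components (delete_vertices G S) = card (pre_digraph.sccs_verts (delete_vertices G S))"
proof -
  interpret D: graph "delete_vertices G S" by (rule graph_delete_vertices)
  show ?thesis
    by (simp add: num_components_def D.graph_components_eq_sccs D.card_sccs_verts)
qed

lemma dominates_delete_vertices:
  "u \<rightarrow>\<^bsub>delete_vertices G S\<^esub> v \<longleftrightarrow> u \<rightarrow>\<^bsub>G\<^esub> v \<and> u \<in> verts G - S \<and> v \<in> verts G - S"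
  by (auto simp: delete_vertices_def arcs_ends_conv image_iff)

lemma (in graph) components_separated:
  "separated_family G S (pre_digraph.sccs_verts (delete_vertices G S))"
proof -
  interpret D: graph "delete_vertices G S" by (rule graph_delete_vertices)
  have vD: "verts (delete_vertices G S) = verts G - S" by (simp add: delete_vertices_def)
  show ?thesis
    unfolding separated_family_def
  proof (intro conjI ballI allI impI)
    show "disjoint D.sccs_verts"
      by (auto simp: disjoint_def dest: D.sccs_verts_disjoint)
    fix C assume C: "C \<in> D.sccs_verts"
    show "C \<noteq> {}" using C by (simp add: D.in_sccs_verts_conv_reachable)
    show sub: "C \<subseteq> verts G - S" using D.sccs_verts_subsets[OF C] vD by simp
    fix u v assume u: "u \<in> C" and uv: "u \<rightarrow>\<^bsub>G\<^esub> v"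
    show "v \<in> C \<union> S"
    proof (rule ccontr)
      assume no: "v \<notin> C \<union> S"
      then have "u \<rightarrow>\<^bsub>delete_vertices G S\<^esub> v"
        using u uv sub adj_in_verts(2)[OF uv] by (auto simp: dominates_delete_vertices)
      moreover from this have "v \<rightarrow>\<^bsub>delete_vertices G S\<^esub> u" by (rule D.dominates_sym)
      ultimately show False
        using C u no D.reachable_adjI unfolding D.in_sccs_verts_conv_reachable by blast
    qed
  qed
qed

text \<open>Rules out the empty set as a vertex cut.\<close>

lemma (in graph) num_components_delete_empty:
  assumes "Digraph_Component.connected G"
  shows "num_components (delete_vertices G {}) = 1"
proof -
  have "delete_vertices G {} = G"
    unfolding delete_vertices_def induce_subgraph_def by (rule pre_digraph.equality) auto
  moreover have "sccs = {G}"
    using symmetric_connected_imp_strongly_connected[OF sym_arcs assms] strongly_connected_eq_iff by blast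
  ultimately show ?thesis
    by (simp add: num_components_def graph_components_eq_sccs)
qed

text \<open>Deleting everything except two nonadjacent vertices leaves two isolated vertices. This
  makes the set under \<open>Min\<close> in \<open>toughness\<close> nonempty.\<close>

lemma (in graph) vertex_cut_exists:
  assumes "\<not> (\<exists>n. complete_digraph n G)"
  shows "\<exists>S. vertex_cut G S"
proof -
  have "arcs_ends G \<noteq> {(u, v). (u, v) \<in> verts G \<times> verts G \<and> u \<noteq> v}"
    using assms graph_axioms unfolding complete_digraph_def by blast
  moreover have "arcs_ends G \<subseteq> {(u, v). (u, v) \<in> verts G \<times> verts G \<and> u \<noteq> v}"
    using adj_not_same adj_in_verts by auto
  ultimately obtain u v where uv: "u \<in> verts G" "v \<in> verts G" "u \<noteq> v" "\<not> u \<rightarrow>\<^bsub>G\<^esub> v" by blast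
  define S where "S = verts G - {u, v}"
  interpret D: graph "delete_vertices G S" by (rule graph_delete_vertices)
  have vD: "verts (delete_vertices G S) = {u, v}"
    using uv by (auto simp: delete_vertices_def S_def)
  have "\<not> v \<rightarrow>\<^bsub>G\<^esub> u" using uv dominates_sym by blast
  then have no: "arcs_ends (delete_vertices G S) = {}"
    using uv adj_not_same by (auto simp: dominates_delete_vertices S_def)
  have triv: "x = y" if "x \<rightarrow>\<^sup>*\<^bsub>delete_vertices G S\<^esub> y" for x y
    using that no by (induction rule: D.reachable_induct) auto
  have "{x} \<in> D.sccs_verts" if "x \<in> {u, v}" for x
    unfolding D.in_sccs_verts_conv_reachable using that triv vD by auto
  then have "{{u}, {v}} \<subseteq> D.sccs_verts" by auto
  then have "card {{u}, {v}} \<le> card D.sccs_verts"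
    by (rule card_mono[OF D.finite_sccs_verts])
  then have "num_components (delete_vertices G S) \<ge> 2"
    using uv by (simp add: num_components_eq)
  then show ?thesis unfolding vertex_cut_def S_def by blast
qed

lemma (in graph) components_le:
  assumes b: "b \<ge> 1" and conn: "Digraph_Component.connected G"
    and reg: "regular_graph d G" and spec: "graph_lambda 2 G < phi d b" and cut: "vertex_cut G S"
  shows "num_components (delete_vertices G S) \<le> b * card S"
proof (rule ccontr)
  assume "\<not> ?thesis"
  then have many: "card (pre_digraph.sccs_verts (delete_vertices G S)) > b * card S"
    by (simp add: num_components_eq)
  interpret D: graph "delete_vertices G S" by (rule graph_delete_vertices)
  have S: "S \<subseteq> verts G" "S \<noteq> {}"
    using cut num_components_delete_empty[OF conn] by (auto simp: vertex_cut_def)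
  note fam = components_separated[of S]
  obtain C1 C2 where C: "C1 \<in> D.sccs_verts" "C2 \<in> D.sccs_verts" "C1 \<noteq> C2"
    and sparse: "\<And>C. C \<in> {C1, C2} \<Longrightarrow> b * (\<Sum>u\<in>C. deficiency C (\<lambda>u v. u \<rightarrow>\<^bsub>G\<^esub> v) d u) < d"
    using two_sparse_components[OF b conn reg S fam D.finite_sccs_verts many] by blast
  have ray: "rayleigh_ge C (\<lambda>u v. u \<rightarrow>\<^bsub>G\<^esub> v) (phi d b)" if "C \<in> {C1, C2}" for C
  proof (rule near_regular.rayleigh_ge_phi[OF _ b sparse[OF that]])
    show "near_regular C (\<lambda>u v. u \<rightarrow>\<^bsub>G\<^esub> v) d"
      using separated_family_near_regular(1)[OF reg fam] C that by auto
  qed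
  have disj: "C1 \<inter> C2 = {}" using C D.sccs_verts_disjoint by blast
  have "C1 \<subseteq> verts G - S" "C2 \<subseteq> verts G - S"
    and closed: "\<And>u v. u \<in> C1 \<Longrightarrow> u \<rightarrow>\<^bsub>G\<^esub> v \<Longrightarrow> v \<in> C1 \<union> S"
    using fam C unfolding separated_family_def by auto
  moreover have "\<not> u \<rightarrow>\<^bsub>G\<^esub> v" if "u \<in> C1" "v \<in> C2" for u v
    using closed[OF that(1)] that calculation(2) disj by blast
  ultimately have "graph_lambda 2 G \<ge> phi d b"
    using disj ray by (intro graph_lambda_2_ge[of C1 C2]) auto
  then show False using spec by simp
qed

theorem theorem1p3:
  fixes G :: "('a, 'b) pre_digraph" and d b :: nat
  assumes "d \<ge> 1" and "b \<ge> 1"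
    and "graph G" and "Digraph_Component.connected G" and "regular_graph d G"
    and "graph_lambda 2 G < phi d b"
  shows "tough (1 / real b) G"
proof (cases "\<exists>n. complete_digraph n G")
  case True
  then show ?thesis by (simp add: tough_def)
next
  case False
  interpret graph G by fact
  define ratio where "ratio S = real (card S) / real (num_components (delete_vertices G S))" for S
  define T where "T = {ratio S | S. vertex_cut G S}"
  have "T \<subseteq> ratio ` Pow (verts G)" by (auto simp: T_def vertex_cut_def)
  then have "finite T" by (rule finite_subset) simp
  moreover have "T \<noteq> {}" using vertex_cut_exists[OF False] by (auto simp: T_def)
  \<comment> \<open>The minimum is attained, so it is enough to bound the ratio of a single
    cut.\<close>
  ultimately have "Min T \<in> T" by (rule Min_in)
  then obtain S where S: "vertex_cut G S" "toughness G = ratio S"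
    by (auto simp: T_def toughness_def ratio_def)
  have "real (num_components (delete_vertices G S)) \<le> real b * real (card S)"
    using components_le[OF assms(2,4,5,6) S(1)] by (metis of_nat_le_iff of_nat_mult)
  moreover have "num_components (delete_vertices G S) > 0" using S(1) by (simp add: vertex_cut_def)
  ultimately have "1 / real b \<le> ratio S" using assms(2) by (simp add: ratio_def field_simps)
  then show ?thesis using S(2) by (simp add: tough_def)
qed

end
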